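(* Let $\{X_{n,k},\ 1\leqslant k\leqslant n,\ n\geqslant 1\}$ be a triangular array of row-wise END random variables with dominating sequence $\{M_n,\ n\geqslant 1\}$, weakly mean dominated by a random variable $X$ with $\mathbb{E}|X|<\infty$. Let $\{a_n\}$ be a positive increasing sequence of constants with increasing extension $a(\cdot)$, and let $\{b_n\}$, $\{s_n\}$ be positive nondecreasing sequences of constants with nondecreasing extensions $b(\cdot)$, $s(\cdot)$ respectively. Suppose that (a) $\displaystyle \sum_{k=1}^{n}\left[\mathbb{E}\left(X_{n,k}^{2}I_{\{|X_{n,k}|\leqslant a_n\}}\right)+a_n^{2}\,\mathbb{P}\{|X_{n,k}|>a_n\}\right]\leqslant s_n$ for every $n\geqslant 1$; (b) $\displaystyle \frac{s_n}{a_nb_n}=o(1)$ as $n\to\infty$; (c) $\displaystyle \frac{s_n}{a_n^{2}\operatorname{Log} n}=o(1)$ as $n\to\infty$; (d) $\displaystyle \liminf_{n\to\infty}\frac{b_n\operatorname{Log}(a_nb_n/s_n)}{a_n\operatorname{Log}(n^{\delta})}>1$ for all $\delta>0$; (e) $\displaystyle \int_{0}^{\infty}\frac{1}{\operatorname{Log} u}\int_{\lfloor u\rfloor}^{\infty}\operatorname{Log}\left[\frac{a(t)b(t)}{s(t)}\right]\mathbb{P}\{a^{-1}(|X|)>t\}\,\mathrm{d}t\,\mathrm{d}u<\infty$; (f) $\displaystyle \int_{0}^{\infty}\mathbb{P}\{|X|>t\}\int_{0}^{\lfloor a^{-1}(t)\rfloor}\frac{u}{b(u)}\,\mathrm{d}u\,\mathrm{d}t<\infty$;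 (g) $M_n=O(n^{\alpha})$ as $n\to\infty$ for some $\alpha>0$. Then $$\sum_{n=1}^{\infty}\mathbb{P}\left\{\left|\frac{1}{b_n}\sum_{k=1}^{n}(X_{n,k}-\mathbb{E}X_{n,k})\right|>\varepsilon\right\}<\infty\quad\text{for all }\varepsilon>0,$$ and $\displaystyle \frac{1}{b_n}\sum_{k=1}^{n}(X_{n,k}-\mathbb{E}X_{n,k})\to 0$ almost surely as $n\to\infty$.
   Context: All random variables are real-valued and defined on a common probability space $(\Omega,\mathcal F,\mathbb P)$; $I_A$ is the indicator of the event $A$. $\operatorname{Log} x$ denotes $\log\max\{x,e\}$ (natural logarithm), and $\lfloor x\rfloor$ is the largest integer not greater than $x$. A triangular array $\{X_{n,k},\ 1\leqslant k\leqslant n,\ n\geqslant 1\}$ is row-wise extended negatively dependent (row-wise END) with dominating sequence $\{M_n,\ n\geqslant 1\}$ if, for each $n\geqslant 1$, $M_n$ is a positive finite number such that both $$\mathbb{P}(X_{n,1}>x_1,\ldots,X_{n,n}>x_n)\leqslant M_n\prod_{k=1}^{n}\mathbb{P}(X_{n,k}>x_k)$$ and $$\mathbb{P}(X_{n,1}\leqslant x_1,\ldots,X_{n,n}\leqslant x_n)\leqslant M_n\prod_{k=1}^{n}\mathbb{P}(X_{n,k}\leqslant x_k)$$ hold for all real numbers $x_1,\ldots,x_n$. The array is weakly mean dominated by a random variable $X$ if, for some constant $C>0$, $\frac1n\sum_{k=1}^{n}\mathbb{P}\{|X_{n,k}|>t\}\leqslant C\,\mathbb{P}\{|X|>t\}$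 for all $t>0$ and every $n\geqslant 1$. A monotone extension of a positive monotone sequence $\{u_n\}$ is a continuous monotone function $u(\cdot)$ on $[0,\infty)$ with $u(n)=u_n$ for all $n\geqslant 1$ ("increasing" means strictly increasing); extensions are taken positive on $(0,\infty)$. $a^{-1}$ is the generalized inverse of $a(\cdot)$: the ordinary inverse on the range of $a(\cdot)$, equal to $0$ below $a(0)$ and to $+\infty$ at or above $\sup_t a(t)$ when that value is not attained. *)

theory Defs
  imports "HOL-Probability.Probability" "HOL-Library.Landau_Symbols"
begin

definition Log :: "real \<Rightarrow> real" where
  "Log x = ln (max x (exp 1))"

text \<open>Only the entries \<open>X n k\<close> with \<open>1 \<le> k \<le> n\<close> matter.\<close>

definition row_wise_END ::
  "'w measure \<Rightarrow> (nat \<Rightarrow> nat \<Rightarrow> 'w \<Rightarrow> real) \<Rightarrow> (nat \<Rightarrow> real) \<Rightarrow> bool" where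
  "row_wise_END P X M \<longleftrightarrow>
     (\<forall>n\<ge>1. M n > 0 \<and>
       (\<forall>x :: nat \<Rightarrow> real.
          measure P {\<omega> \<in> space P. \<forall>k\<in>{1..n}. X n k \<omega> > x k}
            \<le> M n * (\<Prod>k=1..n. measure P {\<omega> \<in> space P. X n k \<omega> > x k}) \<and>
          measure P {\<omega> \<in> space P. \<forall>k\<in>{1..n}. X n k \<omega> \<le> x k}
            \<le> M n * (\<Prod>k=1..n. measure P {\<omega> \<in> space P. X n k \<omega> \<le> x k})))"

definition weakly_mean_dominated ::
  "'w measure \<Rightarrow> (nat \<Rightarrow> nat \<Rightarrow> 'w \<Rightarrow> real) \<Rightarrow> ('w \<Rightarrow> real) \<Rightarrow> bool" where
  "weakly_mean_dominated P X Y \<longleftrightarrow>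
     (\<exists>C>0. \<forall>t>0. \<forall>n\<ge>1.
        1 / real n * (\<Sum>k=1..n. measure P {\<omega> \<in> space P. \<bar>X n k \<omega>\<bar> > t})
          \<le> C * measure P {\<omega> \<in> space P. \<bar>Y \<omega>\<bar> > t})"

definition increasing_extension :: "(nat \<Rightarrow> real) \<Rightarrow> (real \<Rightarrow> real) \<Rightarrow> bool" where
  "increasing_extension u f \<longleftrightarrow>
     continuous_on {0..} f \<and> strict_mono_on {0..} f \<and>
     (\<forall>n\<ge>1. f (real n) = u n) \<and> (\<forall>t>0. f t > 0)"

definition nondecreasing_extension :: "(nat \<Rightarrow> real) \<Rightarrow> (real \<Rightarrow> real) \<Rightarrow> bool" where
  "nondecreasing_extension u f \<longleftrightarrow>
     continuous_on {0..} f \<and> mono_on {0..} f \<and>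
     (\<forall>n\<ge>1. f (real n) = u n) \<and> (\<forall>t>0. f t > 0)"

text \<open>Generalized inverse of a continuous, strictly increasing function on \<open>[0, \<infinity>)\<close>.
  The range of such a function is the interval from \<open>f 0\<close> (included) to its supremum
  (not attained), so the last branch is reached exactly at and above the supremum.\<close>

definition gen_inverse :: "(real \<Rightarrow> real) \<Rightarrow> real \<Rightarrow> ereal" where
  "gen_inverse f y =
     (if y < f 0 then 0
      else if y \<in> f ` {0..} then ereal (the_inv_into {0..} f y)
      else \<infinity>)"

definition ereal_floor :: "ereal \<Rightarrow> ereal" where
  "ereal_floor x = (if \<bar>x\<bar> = \<infinity> then x else ereal (real_of_int \<lfloor>real_of_ereal x\<rfloor>))"

end

theory Submission
  imports Defs
begin

text \<open>Write \<open>T\<^sub>n\<close> for the centred row sum. The proof bounds \<open>P(\<bar>T\<^sub>n\<bar> > \<epsilon> b\<^sub>n)\<close> by a summable sequence; almost sure convergence is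
  then the Borel--Cantelli lemma. Each row is split at the level \<open>a\<^sub>n\<close>:
  \<open>x = min x a\<^sub>n + (x - a\<^sub>n)\<^sup>+\<close>, and the two parts are summable for unrelated reasons.

  The truncated part has finite exponential moments. Extended negative dependence compares the
  probabilities of orthants with products; since a product of nondecreasing functions of the entries
  is a mixture of indicators of orthants, the same comparison, with the same constant \<open>M\<^sub>n\<close>, holds for
  \<open>E \<Prod> exp (\<lambda> min X\<^sub>n\<^sub>k a\<^sub>n)\<close> (\<open>expectation_prod_exp_le\<close>). Only the cut from above is applied to the
  summands: it keeps the layers \<open>{u \<le> exp (\<lambda> min X a\<^sub>n)}\<close> of the exact form \<open>{y \<le> X}\<close>, whereas a cut from below
  would produce layers that are the whole space. The cut from below enters only afterwards, through
  \<open>min x a \<le> clip a x\<close>, when the factors are estimated one at a time. The Bernstein--Chernoff bound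
  with variance proxy \<open>s\<^sub>n\<close>, at the point \<open>\<lambda> = ln q\<^sub>n / a\<^sub>n\<close> with \<open>q\<^sub>n = a\<^sub>n b\<^sub>n / s\<^sub>n\<close>, is
  \<open>M\<^sub>n exp (b\<^sub>n/a\<^sub>n - (\<epsilon>/2) (b\<^sub>n/a\<^sub>n) ln q\<^sub>n)\<close>. By (b) \<open>q\<^sub>n\<close> tends to infinity, so the second term of the exponent dominates
  the first; by (d) it exceeds any multiple of \<open>ln n\<close>; and (g) says that \<open>M\<^sub>n\<close> is polynomial
  (\<open>exponential_bound_eventually_le\<close>).

  The part above the level is small in mean. By Markov's inequality its contribution is at most
   a constant times \<open>(1/b\<^sub>n) \<Sum>\<^sub>k E (\<bar>X\<^sub>n\<^sub>k\<bar> - a\<^sub>n)\<^sup>+\<close>, which mean domination bounds by a constant times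
  \<open>(n/b\<^sub>n) \<integral> P(\<bar>Y\<bar> > t) dt\<close> over \<open>t > a\<^sub>n\<close>. Summing over \<open>n\<close> and exchanging sum and integral leaves
  \<open>\<integral> P(\<bar>Y\<bar> > t) \<Sum>{n/b\<^sub>n. a\<^sub>n < t} dt\<close>, and this is hypothesis (f) up to a constant (\<open>summable_mean_excess\<close>).\<close>

section \<open>Products of exponentials under orthant domination\<close>

text \<open>A product of mixtures \<open>\<integral> h k \<omega> u du\<close> is a single mixture over points \<open>x\<close> of the product space, by Tonelli.
  Hence an inequality between an expected product and a product of expectations that holds with
  one constant for every choice of the parameters passes to the mixtures.\<close>

lemma nn_integral_prod_mixture_le:
  fixes h :: "'i \<Rightarrow> 'w \<Rightarrow> real \<Rightarrow> ennreal"
  assumes "sigma_finite_measure P" and fin: "finite I"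
    and meas: "\<And>k. k \<in> I \<Longrightarrow> case_prod (h k) \<in> borel_measurable (P \<Otimes>\<^sub>M lborel)"
    and dom: "\<And>x. (\<integral>\<^sup>+\<omega>. (\<Prod>k\<in>I. h k \<omega> (x k)) \<partial>P) \<le> K * (\<Prod>k\<in>I. \<integral>\<^sup>+\<omega>. h k \<omega> (x k) \<partial>P)"
  shows "(\<integral>\<^sup>+\<omega>. (\<Prod>k\<in>I. \<integral>\<^sup>+u. h k \<omega> u \<partial>lborel) \<partial>P)
           \<le> K * (\<Prod>k\<in>I. \<integral>\<^sup>+\<omega>. \<integral>\<^sup>+u. h k \<omega> u \<partial>lborel \<partial>P)"
proof -
  let ?L = "\<lambda>_. lborel :: real measure"
  interpret sigma_finite_measure P by fact
  interpret Q: product_sigma_finite ?L ..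
  interpret QI: finite_product_sigma_finite ?L I using fin by unfold_locales
  interpret PQ: pair_sigma_finite P "Pi\<^sub>M I ?L" ..
  interpret PL: pair_sigma_finite P "lborel :: real measure" ..
  have joint [measurable]: "(\<lambda>(\<omega>, x). \<Prod>k\<in>I. h k \<omega> (x k)) \<in> borel_measurable (P \<Otimes>\<^sub>M Pi\<^sub>M I ?L)"
  proof -
    have "(\<lambda>p. h k (fst p) (snd p k)) \<in> borel_measurable (P \<Otimes>\<^sub>M Pi\<^sub>M I ?L)" if k: "k \<in> I" for k
    proof -
      have "(\<lambda>p. (fst p, snd p k)) \<in> P \<Otimes>\<^sub>M Pi\<^sub>M I ?L \<rightarrow>\<^sub>M P \<Otimes>\<^sub>M lborel"
        using k by measurable
      from measurable_compose[OF this meas[OF k]] show ?thesis by simp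
    qed
    then show ?thesis by (simp add: case_prod_beta)
  qed
  have sect: "h k \<omega> \<in> borel_measurable lborel" if "k \<in> I" "\<omega> \<in> space P" for k \<omega>
    using measurable_Pair2[OF meas[OF that(1)] that(2)] by simp
  have marginal: "(\<lambda>u. \<integral>\<^sup>+\<omega>. h k \<omega> u \<partial>P) \<in> borel_measurable lborel" if "k \<in> I" for k
  proof (rule sigma_finite_measure.borel_measurable_nn_integral[OF assms(1)])
    show "(\<lambda>(u, \<omega>). h k \<omega> u) \<in> borel_measurable (lborel \<Otimes>\<^sub>M P)"
      using measurable_compose[OF measurable_pair_swap' meas[OF that]] by (simp add: case_prod_beta)
  qed
  have "(\<integral>\<^sup>+\<omega>. (\<Prod>k\<in>I. \<integral>\<^sup>+u. h k \<omega> u \<partial>lborel) \<partial>P)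
      = (\<integral>\<^sup>+\<omega>. (\<integral>\<^sup>+x. (\<Prod>k\<in>I. h k \<omega> (x k)) \<partial>Pi\<^sub>M I ?L) \<partial>P)"
    by (intro nn_integral_cong) (subst Q.product_nn_integral_prod, use fin sect in auto)
  also have "\<dots> = (\<integral>\<^sup>+x. (\<integral>\<^sup>+\<omega>. (\<Prod>k\<in>I. h k \<omega> (x k)) \<partial>P) \<partial>Pi\<^sub>M I ?L)"
    by (rule PQ.Fubini'[symmetric]) (use joint in simp)
  also have "\<dots> \<le> (\<integral>\<^sup>+x. K * (\<Prod>k\<in>I. \<integral>\<^sup>+\<omega>. h k \<omega> (x k) \<partial>P) \<partial>Pi\<^sub>M I ?L)"
    by (intro nn_integral_mono dom)
  also have "\<dots> = K * (\<integral>\<^sup>+x. (\<Prod>k\<in>I. \<integral>\<^sup>+\<omega>. h k \<omega> (x k) \<partial>P) \<partial>Pi\<^sub>M I ?L)"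
  proof (rule nn_integral_cmult)
    have "(\<lambda>x. \<integral>\<^sup>+\<omega>. h k \<omega> (x k) \<partial>P) \<in> borel_measurable (Pi\<^sub>M I ?L)" if "k \<in> I" for k
      by (rule measurable_compose[OF measurable_component_singleton[OF that] marginal[OF that]])
    then show "(\<lambda>x. \<Prod>k\<in>I. \<integral>\<^sup>+\<omega>. h k \<omega> (x k) \<partial>P) \<in> borel_measurable (Pi\<^sub>M I ?L)"
      by measurable
  qed
  also have "\<dots> = K * (\<Prod>k\<in>I. \<integral>\<^sup>+u. \<integral>\<^sup>+\<omega>. h k \<omega> u \<partial>P \<partial>lborel)"
    by (subst Q.product_nn_integral_prod) (use fin marginal in auto)
  also have "\<dots> = K * (\<Prod>k\<in>I. \<integral>\<^sup>+\<omega>. \<integral>\<^sup>+u. h k \<omega> u \<partial>lborel \<partial>P)"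
    by (intro arg_cong2[where f="(*)"] refl prod.cong PL.Fubini' meas)
  finally show ?thesis .
qed

text \<open>Half of extended negative dependence, for closed orthants: the other half is the same property
  of the negated family, so that both tails of a sum can be treated by one argument.\<close>

definition orthant_dominated :: "'w measure \<Rightarrow> 'i set \<Rightarrow> ('i \<Rightarrow> 'w \<Rightarrow> real) \<Rightarrow> real \<Rightarrow> bool" where
  "orthant_dominated P I Z K \<longleftrightarrow>
     (\<forall>x. measure P {\<omega> \<in> space P. \<forall>k\<in>I. x k \<le> Z k \<omega>}
            \<le> K * (\<Prod>k\<in>I. measure P {\<omega> \<in> space P. x k \<le> Z k \<omega>}))"

text \<open>Closed orthants are decreasing limits of open ones, and there are finitely many factors.\<close>

lemma (in prob_space) orthant_dominatedI_open:
  assumes fin: "finite I" and Z [measurable]: "\<And>k. k \<in> I \<Longrightarrow> Z k \<in> borel_measurable M"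
    and dom: "\<And>x :: 'i \<Rightarrow> real. prob {\<omega> \<in> space M. \<forall>k\<in>I. x k < Z k \<omega>}
               \<le> K * (\<Prod>k\<in>I. prob {\<omega> \<in> space M. x k < Z k \<omega>})"
  shows "orthant_dominated M I Z K"
  unfolding orthant_dominated_def
proof
  fix x :: "'i \<Rightarrow> real"
  define d where "d = (\<lambda>m::nat. 1 / (real m + 1))"
  have d: "d m > 0" "m \<le> m' \<Longrightarrow> d m' \<le> d m" for m m'
    by (auto simp: d_def field_simps)
  have d0: "d \<longlonglongrightarrow> 0"
    unfolding d_def using LIMSEQ_inverse_real_of_nat by (simp add: inverse_eq_divide add.commute)
  have lim: "(\<lambda>m. prob {\<omega> \<in> space M. \<forall>k\<in>J. x k - d m < Z k \<omega>})
               \<longlonglongrightarrow> prob {\<omega> \<in> space M. \<forall>k\<in>J. x k \<le> Z k \<omega>}" if J: "J \<subseteq> I" for J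
  proof -
    have [measurable]: "Z k \<in> borel_measurable M" if "k \<in> J" for k using J that Z by auto
    have [simp]: "finite J" "countable J" using J fin finite_subset countable_finite by blast+
    have "(\<lambda>m. prob {\<omega> \<in> space M. \<forall>k\<in>J. x k - d m < Z k \<omega>})
               \<longlonglongrightarrow> prob (\<Inter>m. {\<omega> \<in> space M. \<forall>k\<in>J. x k - d m < Z k \<omega>})"
    proof (rule finite_Lim_measure_decseq)
      show "range (\<lambda>m. {\<omega> \<in> space M. \<forall>k\<in>J. x k - d m < Z k \<omega>}) \<subseteq> events"
        by auto
      show "decseq (\<lambda>m. {\<omega> \<in> space M. \<forall>k\<in>J. x k - d m < Z k \<omega>})"
        using d(2) by (fastforce simp: decseq_def)
    qed
    also have "(\<Inter>m. {\<omega> \<in> space M. \<forall>k\<in>J. x k - d m < Z k \<omega>})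
        = {\<omega> \<in> space M. \<forall>k\<in>J. x k \<le> Z k \<omega>}"
    proof (intro equalityI subsetI)
      fix \<omega> assume \<omega>: "\<omega> \<in> (\<Inter>m. {\<omega> \<in> space M. \<forall>k\<in>J. x k - d m < Z k \<omega>})"
      have "x k \<le> Z k \<omega>" if "k \<in> J" for k
      proof -
        have "(\<lambda>m. x k - d m) \<longlonglongrightarrow> x k - 0" by (intro tendsto_intros d0)
        moreover have "x k - d m \<le> Z k \<omega>" for m using \<omega> that by (auto intro: less_imp_le)
        ultimately show ?thesis using LIMSEQ_le_const2[of "\<lambda>m. x k - d m" "x k" "Z k \<omega>"] by auto
      qed
      then show "\<omega> \<in> {\<omega> \<in> space M. \<forall>k\<in>J. x k \<le> Z k \<omega>}" using \<omega> by auto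
    next
      fix \<omega> assume \<omega>: "\<omega> \<in> {\<omega> \<in> space M. \<forall>k\<in>J. x k \<le> Z k \<omega>}"
      have "x k - d m < Z k \<omega>" if "k \<in> J" for k m
        using \<omega> that d(1)[of m] by fastforce
      then show "\<omega> \<in> (\<Inter>m. {\<omega> \<in> space M. \<forall>k\<in>J. x k - d m < Z k \<omega>})" using \<omega> by auto
    qed
    finally show ?thesis .
  qed
  have single: "(\<lambda>m. prob {\<omega> \<in> space M. x k - d m < Z k \<omega>})
               \<longlonglongrightarrow> prob {\<omega> \<in> space M. x k \<le> Z k \<omega>}" if "k \<in> I" for k
    using lim[of "{k}"] that by simp
  show "prob {\<omega> \<in> space M. \<forall>k\<in>I. x k \<le> Z k \<omega>}
          \<le> K * (\<Prod>k\<in>I. prob {\<omega> \<in> space M. x k \<le> Z k \<omega>})"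
  proof (rule LIMSEQ_le[OF lim[OF order_refl]])
    show "(\<lambda>m. K * (\<Prod>k\<in>I. prob {\<omega> \<in> space M. x k - d m < Z k \<omega>}))
            \<longlonglongrightarrow> K * (\<Prod>k\<in>I. prob {\<omega> \<in> space M. x k \<le> Z k \<omega>})"
      by (intro tendsto_intros single)
  qed (use dom[of "\<lambda>k. x k - d _"] in auto)
qed

text \<open>Each variable \<open>U = exp (l * min Z c)\<close> is the integral over \<open>u > 0\<close> of the indicator of \<open>{u \<le> U}\<close>. Such a layer is empty for
  \<open>u > exp (l * c)\<close> and equals \<open>{ln u / l \<le> Z}\<close> otherwise, so products of layers are orthants and the mixture
  inequality applies.\<close>

lemma (in prob_space) expectation_prod_exp_le:
  assumes fin: "finite I" and Z [measurable]: "\<And>k. k \<in> I \<Longrightarrow> Z k \<in> borel_measurable M"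
    and dom: "orthant_dominated M I Z K" and K: "K \<ge> 0" and l: "l > 0"
  shows "expectation (\<lambda>\<omega>. \<Prod>k\<in>I. exp (l * min (Z k \<omega>) c))
           \<le> K * (\<Prod>k\<in>I. expectation (\<lambda>\<omega>. exp (l * min (Z k \<omega>) c)))"
proof -
  let ?U = "\<lambda>k \<omega>. exp (l * min (Z k \<omega>) c)"
  define h where "h = (\<lambda>k \<omega> u. indicator {p. 0 < snd p \<and> snd p \<le> fst p} (?U k \<omega>, u) :: ennreal)"
  have h_meas: "case_prod (h k) \<in> borel_measurable (M \<Otimes>\<^sub>M lborel)" if "k \<in> I" for k
  proof -
    have [measurable]: "Z k \<in> borel_measurable M" using that Z by simp
    show ?thesis unfolding h_def by measurable
  qed
  have layer: "(\<integral>\<^sup>+u. h k \<omega> u \<partial>lborel) = ennreal (?U k \<omega>)" for k \<omega>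
  proof -
    have "(\<integral>\<^sup>+u. h k \<omega> u \<partial>lborel) = (\<integral>\<^sup>+u. indicator {0<..?U k \<omega>} u \<partial>lborel)"
      by (intro nn_integral_cong) (auto simp: h_def indicator_def)
    then show ?thesis by simp
  qed
  have h_dom: "(\<integral>\<^sup>+\<omega>. (\<Prod>k\<in>I. h k \<omega> (x k)) \<partial>M) \<le> ennreal K * (\<Prod>k\<in>I. \<integral>\<^sup>+\<omega>. h k \<omega> (x k) \<partial>M)"
    for x :: "'b \<Rightarrow> real"
  proof (cases "\<forall>k\<in>I. 0 < x k \<and> x k \<le> exp (l * c)")
    case False
    then obtain k where k: "k \<in> I" "\<not> (0 < x k \<and> x k \<le> exp (l * c))" by blast
    have "\<not> (0 < x k \<and> x k \<le> ?U k \<omega>)" for \<omega>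
    proof -
      have "?U k \<omega> \<le> exp (l * c)" using l by simp
      then show ?thesis using k(2) by linarith
    qed
    then have "h k \<omega> (x k) = 0" for \<omega> by (simp add: h_def indicator_def)
    then have "(\<Prod>k\<in>I. h k \<omega> (x k)) = 0" for \<omega> using fin k(1) by (intro prod_zero) auto
    then have "(\<integral>\<^sup>+\<omega>. (\<Prod>k\<in>I. h k \<omega> (x k)) \<partial>M) = (\<integral>\<^sup>+\<omega>. 0 \<partial>M)"
      by (intro nn_integral_cong)
    then show ?thesis by (simp only: nn_integral_const) simp
  next
    case True
    define y where "y k = ln (x k) / l" for k
    have h_eq: "h k \<omega> (x k) = indicator {\<omega> \<in> space M. y k \<le> Z k \<omega>} \<omega>"
      if k: "k \<in> I" and "\<omega> \<in> space M" for k \<omega>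
    proof -
      have x: "0 < x k" "x k \<le> exp (l * c)" using True k by auto
      have "ln (x k) \<le> l * c" using x by (metis exp_gt_zero ln_exp ln_le_cancel_iff)
      moreover have "x k \<le> ?U k \<omega> \<longleftrightarrow> ln (x k) \<le> l * min (Z k \<omega>) c"
        using x by (metis exp_gt_zero ln_exp ln_le_cancel_iff)
      moreover have "l * min (Z k \<omega>) c = min (l * Z k \<omega>) (l * c)"
        using l by (simp add: min_mult_distrib_left)
      ultimately have "x k \<le> ?U k \<omega> \<longleftrightarrow> y k \<le> Z k \<omega>"
        using l by (simp add: y_def field_simps)
      then show ?thesis using x that by (simp add: h_def indicator_def)
    qed
    have ev [measurable]: "{\<omega> \<in> space M. y k \<le> Z k \<omega>} \<in> events" if "k \<in> I" for k
      using Z[OF that] by measurable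
    have evI: "{\<omega> \<in> space M. \<forall>k\<in>I. y k \<le> Z k \<omega>} \<in> events"
      using fin ev by (intro sets.sets_Collect_finite_All) auto
    have "(\<integral>\<^sup>+\<omega>. (\<Prod>k\<in>I. h k \<omega> (x k)) \<partial>M)
        = (\<integral>\<^sup>+\<omega>. indicator {\<omega> \<in> space M. \<forall>k\<in>I. y k \<le> Z k \<omega>} \<omega> \<partial>M)"
    proof (intro nn_integral_cong)
      fix \<omega> assume \<omega>: "\<omega> \<in> space M"
      have "(\<Prod>k\<in>I. h k \<omega> (x k)) = (\<Prod>k\<in>I. if y k \<le> Z k \<omega> then 1 else 0)"
        using h_eq \<omega> by (intro prod.cong) auto
      also have "\<dots> = indicator {\<omega> \<in> space M. \<forall>k\<in>I. y k \<le> Z k \<omega>} \<omega>"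
        using \<omega> fin by (auto simp: indicator_def intro!: prod.neutral prod_zero)
      finally show "(\<Prod>k\<in>I. h k \<omega> (x k)) = indicator {\<omega> \<in> space M. \<forall>k\<in>I. y k \<le> Z k \<omega>} \<omega>" .
    qed
    also have "\<dots> = ennreal (prob {\<omega> \<in> space M. \<forall>k\<in>I. y k \<le> Z k \<omega>})"
      using evI by (simp add: emeasure_eq_measure)
    also have "\<dots> \<le> ennreal (K * (\<Prod>k\<in>I. prob {\<omega> \<in> space M. y k \<le> Z k \<omega>}))"
      using dom by (intro ennreal_leI) (auto simp: orthant_dominated_def)
    also have "\<dots> = ennreal K * (\<Prod>k\<in>I. emeasure M {\<omega> \<in> space M. y k \<le> Z k \<omega>})"
      using K by (simp add: ennreal_mult prod_nonneg prod_ennreal emeasure_eq_measure)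
    also have "(\<Prod>k\<in>I. emeasure M {\<omega> \<in> space M. y k \<le> Z k \<omega>}) = (\<Prod>k\<in>I. \<integral>\<^sup>+\<omega>. h k \<omega> (x k) \<partial>M)"
    proof (intro prod.cong refl)
      fix k assume k: "k \<in> I"
      have "(\<integral>\<^sup>+\<omega>. h k \<omega> (x k) \<partial>M) = (\<integral>\<^sup>+\<omega>. indicator {\<omega> \<in> space M. y k \<le> Z k \<omega>} \<omega> \<partial>M)"
        using h_eq k by (intro nn_integral_cong) auto
      then show "emeasure M {\<omega> \<in> space M. y k \<le> Z k \<omega>} = (\<integral>\<^sup>+\<omega>. h k \<omega> (x k) \<partial>M)"
        using ev[OF k] by simp
    qed
    finally show ?thesis .
  qed
  have int: "integrable M (?U k)" if "k \<in> I" for k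
    using l that Z[OF that] by (intro integrable_const_bound[where B="exp (l * c)"]) auto
  have intp: "integrable M (\<lambda>\<omega>. \<Prod>k\<in>I. ?U k \<omega>)"
  proof (rule integrable_const_bound[where B="\<Prod>k\<in>I. exp (l * c)"])
    have "norm (\<Prod>k\<in>I. ?U k \<omega>) \<le> (\<Prod>k\<in>I. exp (l * c))" for \<omega>
    proof -
      have "(\<Prod>k\<in>I. ?U k \<omega>) \<le> (\<Prod>k\<in>I. exp (l * c))" using l by (intro prod_mono) auto
      then show ?thesis by (simp add: abs_prod del: prod_constant)
    qed
    then show "AE \<omega> in M. norm (\<Prod>k\<in>I. ?U k \<omega>) \<le> (\<Prod>k\<in>I. exp (l * c))" by simp
  qed measurable
  have "ennreal (expectation (\<lambda>\<omega>. \<Prod>k\<in>I. ?U k \<omega>)) = (\<integral>\<^sup>+\<omega>. (\<Prod>k\<in>I. ennreal (?U k \<omega>)) \<partial>M)"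
    by (subst nn_integral_eq_integral[symmetric, OF intp]) (auto simp: prod_nonneg prod_ennreal)
  also have "\<dots> \<le> ennreal K * (\<Prod>k\<in>I. \<integral>\<^sup>+\<omega>. ennreal (?U k \<omega>) \<partial>M)"
    using nn_integral_prod_mixture_le[OF sigma_finite_measure_axioms fin h_meas h_dom]
    by (simp add: layer)
  also have "\<dots> = ennreal (K * (\<Prod>k\<in>I. expectation (?U k)))"
    using K by (simp add: nn_integral_eq_integral[OF int] prod_ennreal ennreal_mult prod_nonneg)
  finally show ?thesis
    using K by (subst (asm) ennreal_le_iff) (auto intro!: mult_nonneg_nonneg prod_nonneg)
qed

section \<open>Truncation and the tail of a centred sum\<close>

definition clip :: "real \<Rightarrow> real \<Rightarrow> real" where
  "clip c x = max (- c) (min x c)"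

definition excess :: "real \<Rightarrow> real \<Rightarrow> real" where
  "excess c x = max 0 (\<bar>x\<bar> - c)"

lemma clip_measurable [measurable]: "clip c \<in> borel_measurable borel"
  unfolding clip_def by measurable

lemma excess_measurable [measurable]: "excess c \<in> borel_measurable borel"
  unfolding excess_def by measurable

lemma clip_uminus: "c \<ge> 0 \<Longrightarrow> clip c (- x) = - clip c x"
  by (auto simp: clip_def)

lemma excess_uminus: "excess c (- x) = excess c x"
  by (simp add: excess_def)

lemma abs_clip_le: "c \<ge> 0 \<Longrightarrow> \<bar>clip c x\<bar> \<le> c"
  by (auto simp: clip_def)

lemma abs_diff_clip: "c \<ge> 0 \<Longrightarrow> \<bar>x - clip c x\<bar> = excess c x"
  by (auto simp: clip_def excess_def)

lemma min_le_clip: "min x c \<le> clip c x"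
  by (simp add: clip_def)

lemma diff_min_le_excess: "x - min x c \<le> excess c x"
  by (auto simp: excess_def)

lemma excess_nonneg: "excess c x \<ge> 0"
  by (simp add: excess_def)

text \<open>The ratio \<open>(exp x - 1 - x) / x\<^sup>2\<close> has a power series with nonnegative coefficients, so on \<open>\<bar>x\<bar> \<le> c\<close> it is largest
  at \<open>c\<close>. The division by \<open>c\<^sup>2\<close>, which the Lagrange remainder of the Taylor formula would not give, later makes
  the second-moment term \<open>(s/a\<^sup>2) exp (l * a)\<close> of the Chernoff bound as small as \<open>b/a\<close>.\<close>

lemma exp_le_quadratic:
  fixes x c :: real
  assumes x: "\<bar>x\<bar> \<le> c" and c: "c > 0"
  shows "exp x \<le> 1 + x + x\<^sup>2 / c\<^sup>2 * exp c"
proof -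
  let ?t = "\<lambda>y n. inverse (fact (n + 2)) * y ^ (n + 2) :: real"
  have sm: "summable (?t y)" for y
    using summable_ignore_initial_segment[OF summable_exp[of y], of 2] by simp
  have tail: "exp y = 1 + y + (\<Sum>n. ?t y n)" for y :: real
    using exp_first_two_terms[of y] by simp
  have "?t x n \<le> x\<^sup>2 / c\<^sup>2 * ?t c n" for n
  proof -
    have "x ^ n \<le> c ^ n"
      using power_mono[OF x, of n] by (metis abs_ge_self abs_ge_zero order_trans power_abs)
    then have "inverse (fact (n + 2)) * (x\<^sup>2 * x ^ n) \<le> inverse (fact (n + 2)) * (x\<^sup>2 * c ^ n)"
      by (intro mult_left_mono) auto
    moreover have "x\<^sup>2 / c\<^sup>2 * ?t c n = inverse (fact (n + 2)) * (x\<^sup>2 * c ^ n)"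
      using c by (simp add: field_simps power2_eq_square)
    moreover have "?t x n = inverse (fact (n + 2)) * (x\<^sup>2 * x ^ n)"
      by (simp add: power2_eq_square)
    ultimately show ?thesis by linarith
  qed
  then have "(\<Sum>n. ?t x n) \<le> (\<Sum>n. x\<^sup>2 / c\<^sup>2 * ?t c n)"
    by (intro suminf_le sm summable_mult)
  also have "\<dots> = x\<^sup>2 / c\<^sup>2 * (\<Sum>n. ?t c n)"
    by (rule suminf_mult[OF sm])
  also have "\<dots> \<le> x\<^sup>2 / c\<^sup>2 * exp c"
    using tail[of c] c by (intro mult_left_mono) auto
  finally show ?thesis using tail[of x] by linarith
qed

lemma (in prob_space) clip_integrable:
  assumes [measurable]: "Z \<in> borel_measurable M" and "c \<ge> 0"
  shows "integrable M (\<lambda>\<omega>. clip c (Z \<omega>))" "integrable M (\<lambda>\<omega>. (clip c (Z \<omega>))\<^sup>2)"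
proof -
  show "integrable M (\<lambda>\<omega>. clip c (Z \<omega>))"
    using abs_clip_le[OF assms(2)] by (intro integrable_const_bound[where B=c]) auto
  have "(clip c y)\<^sup>2 \<le> c\<^sup>2" for y
    using abs_clip_le[OF assms(2), of y] assms(2) by (intro power2_le_iff_abs_le[THEN iffD2])
  then show "integrable M (\<lambda>\<omega>. (clip c (Z \<omega>))\<^sup>2)"
    by (intro integrable_const_bound[where B="c\<^sup>2"]) auto
qed

lemma (in prob_space) expectation_exp_min_le:
  assumes Z [measurable]: "Z \<in> borel_measurable M" and l: "l > 0" and c: "c > 0"
  shows "expectation (\<lambda>\<omega>. exp (l * min (Z \<omega>) c))
     \<le> exp (l * expectation (\<lambda>\<omega>. clip c (Z \<omega>)) + expectation (\<lambda>\<omega>. (clip c (Z \<omega>))\<^sup>2) / c\<^sup>2 * exp (l * c))"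
proof -
  note ci [simp] = clip_integrable[OF Z less_imp_le[OF c]]
  let ?C = "\<lambda>\<omega>. clip c (Z \<omega>)"
  have pt: "exp (l * min (Z \<omega>) c) \<le> 1 + l * ?C \<omega> + (?C \<omega>)\<^sup>2 / c\<^sup>2 * exp (l * c)" for \<omega>
  proof -
    have "exp (l * min (Z \<omega>) c) \<le> exp (l * ?C \<omega>)"
      using l by (simp add: min_le_clip)
    also have "\<dots> \<le> 1 + l * ?C \<omega> + (l * ?C \<omega>)\<^sup>2 / (l * c)\<^sup>2 * exp (l * c)"
      using l c abs_clip_le[of c "Z \<omega>"] by (intro exp_le_quadratic) (auto simp: abs_mult)
    finally show ?thesis using l by (simp add: power_mult_distrib)
  qed
  have "expectation (\<lambda>\<omega>. exp (l * min (Z \<omega>) c))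
      \<le> expectation (\<lambda>\<omega>. 1 + l * ?C \<omega> + (?C \<omega>)\<^sup>2 / c\<^sup>2 * exp (l * c))"
  proof (rule integral_mono)
    show "integrable M (\<lambda>\<omega>. exp (l * min (Z \<omega>) c))"
      using l by (intro integrable_const_bound[where B="exp (l * c)"]) auto
  qed (use pt in auto)
  also have "\<dots> = 1 + (l * expectation ?C + expectation (\<lambda>\<omega>. (?C \<omega>)\<^sup>2) / c\<^sup>2 * exp (l * c))"
    by (simp add: prob_space)
  also have "\<dots> \<le> exp (l * expectation ?C + expectation (\<lambda>\<omega>. (?C \<omega>)\<^sup>2) / c\<^sup>2 * exp (l * c))"
    by (rule exp_ge_add_one_self)
  finally show ?thesis .
qed

text \<open>Chernoff's bound. The summands are cut from above only, but the centring uses the two-sided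
  truncation, whose second moment is finite.\<close>

lemma (in prob_space) truncated_sum_upper_tail:
  assumes fin: "finite I" and Z [measurable]: "\<And>k. k \<in> I \<Longrightarrow> Z k \<in> borel_measurable M"
    and dom: "orthant_dominated M I Z K" and K: "K \<ge> 0" and l: "l > 0" and c: "c > 0"
    and V: "(\<Sum>k\<in>I. expectation (\<lambda>\<omega>. (clip c (Z k \<omega>))\<^sup>2)) \<le> V"
  shows "prob {\<omega> \<in> space M. x \<le> (\<Sum>k\<in>I. min (Z k \<omega>) c - expectation (\<lambda>\<omega>. clip c (Z k \<omega>)))}
           \<le> K * exp (- (l * x) + V / c\<^sup>2 * exp (l * c))"
proof -
  define m where "m = (\<lambda>k. expectation (\<lambda>\<omega>. clip c (Z k \<omega>)))"
  define v where "v = (\<lambda>k. expectation (\<lambda>\<omega>. (clip c (Z k \<omega>))\<^sup>2))"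
  let ?U = "\<lambda>\<omega>. \<Prod>k\<in>I. exp (l * min (Z k \<omega>) c)"
  let ?t = "exp (l * (x + sum m I))"
  have intU: "integrable M ?U"
  proof (rule integrable_const_bound[where B="\<Prod>k\<in>I. exp (l * c)"])
    have "norm (?U \<omega>) \<le> (\<Prod>k\<in>I. exp (l * c))" for \<omega>
    proof -
      have "?U \<omega> \<le> (\<Prod>k\<in>I. exp (l * c))" using l by (intro prod_mono) auto
      then show ?thesis by (simp add: abs_prod del: prod_constant)
    qed
    then show "AE \<omega> in M. norm (?U \<omega>) \<le> (\<Prod>k\<in>I. exp (l * c))" by simp
  qed measurable
  have "?U \<omega> = exp (l * (\<Sum>k\<in>I. min (Z k \<omega>) c))" for \<omega>
    by (simp only: exp_sum[OF fin] sum_distrib_left)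
  then have "?t \<le> ?U \<omega> \<longleftrightarrow> x + sum m I \<le> (\<Sum>k\<in>I. min (Z k \<omega>) c)" for \<omega>
    using l by (simp only: exp_le_cancel_iff mult_le_cancel_left_pos)
  then have "{\<omega> \<in> space M. x \<le> (\<Sum>k\<in>I. min (Z k \<omega>) c - m k)} = {\<omega> \<in> space M. ?t \<le> ?U \<omega>}"
    by (simp only: sum_subtractf le_diff_eq)
  then have "prob {\<omega> \<in> space M. x \<le> (\<Sum>k\<in>I. min (Z k \<omega>) c - m k)} \<le> expectation ?U / ?t"
    using integral_Markov_inequality_measure[OF intU, of "{}" ?t] by (auto simp: prod_nonneg)
  also have "\<dots> \<le> (K * (\<Prod>k\<in>I. exp (l * m k + v k / c\<^sup>2 * exp (l * c)))) / ?t"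
  proof (rule divide_right_mono)
    have "expectation ?U \<le> K * (\<Prod>k\<in>I. expectation (\<lambda>\<omega>. exp (l * min (Z k \<omega>) c)))"
      by (rule expectation_prod_exp_le[OF fin Z dom K l])
    also have "\<dots> \<le> K * (\<Prod>k\<in>I. exp (l * m k + v k / c\<^sup>2 * exp (l * c)))"
      unfolding m_def v_def
      by (intro mult_left_mono prod_mono conjI integral_nonneg_AE K expectation_exp_min_le[OF Z l c]) auto
    finally show "expectation ?U \<le> K * (\<Prod>k\<in>I. exp (l * m k + v k / c\<^sup>2 * exp (l * c)))" .
  qed simp
  also have "\<dots> = K * exp (- (l * x) + sum v I / c\<^sup>2 * exp (l * c))"
  proof -
    have "(\<Prod>k\<in>I. exp (l * m k + v k / c\<^sup>2 * exp (l * c)))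
        = exp (l * sum m I + sum v I / c\<^sup>2 * exp (l * c))"
      by (simp only: exp_sum[OF fin, symmetric] sum.distrib sum_distrib_left sum_distrib_right sum_divide_distrib)
    moreover have "- (l * x) + sum v I / c\<^sup>2 * exp (l * c)
        = (l * sum m I + sum v I / c\<^sup>2 * exp (l * c)) - l * (x + sum m I)"
      by (simp add: distrib_left)
    ultimately show ?thesis by (simp only: exp_diff times_divide_eq_right)
  qed
  also have "\<dots> \<le> K * exp (- (l * x) + V / c\<^sup>2 * exp (l * c))"
    using V K by (intro mult_left_mono) (auto simp: v_def intro!: divide_right_mono mult_right_mono)
  finally show ?thesis by (simp add: m_def)
qed

text \<open>The error made by truncating \<open>Z k\<close> is at most \<open>excess c (Z k)\<close>, the error in the centring at most its mean, and
  together they are controlled by Markov's inequality. Half of \<open>x\<close> is spent on each part.\<close>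

lemma (in prob_space) centred_sum_upper_tail:
  assumes fin: "finite I" and int: "\<And>k. k \<in> I \<Longrightarrow> integrable M (Z k)"
    and dom: "orthant_dominated M I Z K" and K: "K \<ge> 0" and l: "l > 0" and c: "c > 0" and x: "x > 0"
    and V: "(\<Sum>k\<in>I. expectation (\<lambda>\<omega>. (clip c (Z k \<omega>))\<^sup>2)) \<le> V"
  shows "prob {\<omega> \<in> space M. x < (\<Sum>k\<in>I. Z k \<omega> - expectation (Z k))}
           \<le> K * exp (- (l * (x / 2)) + V / c\<^sup>2 * exp (l * c))
             + 4 / x * (\<Sum>k\<in>I. expectation (\<lambda>\<omega>. excess c (Z k \<omega>)))"
proof -
  have Z [measurable]: "Z k \<in> borel_measurable M" if "k \<in> I" for k using int[OF that] by simp
  define m where "m = (\<lambda>k. expectation (\<lambda>\<omega>. clip c (Z k \<omega>)))"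
  define e where "e = (\<lambda>k. expectation (\<lambda>\<omega>. excess c (Z k \<omega>)))"
  let ?T = "\<lambda>\<omega>. \<Sum>k\<in>I. min (Z k \<omega>) c - m k"
  let ?R = "\<lambda>\<omega>. \<Sum>k\<in>I. excess c (Z k \<omega>) + e k"
  have ci: "integrable M (\<lambda>\<omega>. clip c (Z k \<omega>))" if "k \<in> I" for k
    using clip_integrable(1)[OF Z[OF that]] c by simp
  have ei: "integrable M (\<lambda>\<omega>. excess c (Z k \<omega>))" if "k \<in> I" for k
  proof -
    have "integrable M (\<lambda>\<omega>. \<bar>Z k \<omega> - clip c (Z k \<omega>)\<bar>)"
      using int[OF that] ci[OF that] by auto
    then show ?thesis using c by (simp add: abs_diff_clip)
  qed
  have Ri: "integrable M ?R" using ei by auto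
  have ER: "expectation ?R = 2 * sum e I"
    using ei by (simp add: prob_space sum.distrib e_def)
  have split: "(\<Sum>k\<in>I. Z k \<omega> - expectation (Z k)) \<le> ?T \<omega> + ?R \<omega>" for \<omega>
  proof -
    have "Z k \<omega> - expectation (Z k) \<le> (min (Z k \<omega>) c - m k) + (excess c (Z k \<omega>) + e k)" if k: "k \<in> I" for k
    proof -
      have "m k - expectation (Z k) = expectation (\<lambda>\<omega>. clip c (Z k \<omega>) - Z k \<omega>)"
        using ci[OF k] int[OF k] by (simp add: m_def)
      also have "\<dots> \<le> e k"
        unfolding e_def
      proof (rule integral_mono)
        show "clip c (Z k \<omega>) - Z k \<omega> \<le> excess c (Z k \<omega>)" for \<omega>
          using abs_diff_clip[of c "Z k \<omega>"] c by linarith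
      qed (use ci[OF k] int[OF k] ei[OF k] in auto)
      finally show ?thesis using diff_min_le_excess[of "Z k \<omega>" c] by linarith
    qed
    then have "(\<Sum>k\<in>I. Z k \<omega> - expectation (Z k))
        \<le> (\<Sum>k\<in>I. (min (Z k \<omega>) c - m k) + (excess c (Z k \<omega>) + e k))" by (intro sum_mono)
    then show ?thesis by (simp add: sum.distrib)
  qed
  have "prob {\<omega> \<in> space M. x < (\<Sum>k\<in>I. Z k \<omega> - expectation (Z k))}
      \<le> prob ({\<omega> \<in> space M. x / 2 \<le> ?T \<omega>} \<union> {\<omega> \<in> space M. x / 2 \<le> ?R \<omega>})"
  proof (rule finite_measure_mono)
    show "{\<omega> \<in> space M. x < (\<Sum>k\<in>I. Z k \<omega> - expectation (Z k))}
        \<subseteq> {\<omega> \<in> space M. x / 2 \<le> ?T \<omega>} \<union> {\<omega> \<in> space M. x / 2 \<le> ?R \<omega>}"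
    proof
      fix \<omega> assume "\<omega> \<in> {\<omega> \<in> space M. x < (\<Sum>k\<in>I. Z k \<omega> - expectation (Z k))}"
      then have "\<omega> \<in> space M" and "x < ?T \<omega> + ?R \<omega>" using split[of \<omega>] by auto
      moreover from this(2) have "x / 2 \<le> ?T \<omega> \<or> x / 2 \<le> ?R \<omega>" by linarith
      ultimately show "\<omega> \<in> {\<omega> \<in> space M. x / 2 \<le> ?T \<omega>} \<union> {\<omega> \<in> space M. x / 2 \<le> ?R \<omega>}"
        by blast
    qed
  qed measurable
  also have "\<dots> \<le> prob {\<omega> \<in> space M. x / 2 \<le> ?T \<omega>} + prob {\<omega> \<in> space M. x / 2 \<le> ?R \<omega>}"
    by (rule measure_Un_le) measurable
  also have "\<dots> \<le> K * exp (- (l * (x / 2)) + V / c\<^sup>2 * exp (l * c)) + expectation ?R / (x / 2)"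
  proof (rule add_mono)
    show "prob {\<omega> \<in> space M. x / 2 \<le> ?T \<omega>} \<le> K * exp (- (l * (x / 2)) + V / c\<^sup>2 * exp (l * c))"
      unfolding m_def by (rule truncated_sum_upper_tail[OF fin Z dom K l c V])
    have "0 \<le> e k" for k unfolding e_def by (intro integral_nonneg_AE) (auto simp: excess_nonneg)
    then have "0 \<le> ?R \<omega>" for \<omega> by (intro sum_nonneg) (simp add: excess_nonneg)
    then show "prob {\<omega> \<in> space M. x / 2 \<le> ?R \<omega>} \<le> expectation ?R / (x / 2)"
      using integral_Markov_inequality_measure[OF Ri, of "{}" "x / 2"] x by auto
  qed
  finally show ?thesis unfolding ER by (simp add: e_def)
qed

lemma (in prob_space) centred_sum_tail:
  assumes fin: "finite I" and int: "\<And>k. k \<in> I \<Longrightarrow> integrable M (Z k)"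
    and dom: "orthant_dominated M I Z K" "orthant_dominated M I (\<lambda>k \<omega>. - Z k \<omega>) K"
    and K: "K \<ge> 0" and l: "l > 0" and c: "c > 0" and x: "x > 0"
    and V: "(\<Sum>k\<in>I. expectation (\<lambda>\<omega>. (clip c (Z k \<omega>))\<^sup>2)) \<le> V"
  shows "prob {\<omega> \<in> space M. x < \<bar>\<Sum>k\<in>I. Z k \<omega> - expectation (Z k)\<bar>}
           \<le> 2 * (K * exp (- (l * (x / 2)) + V / c\<^sup>2 * exp (l * c))
             + 4 / x * (\<Sum>k\<in>I. expectation (\<lambda>\<omega>. excess c (Z k \<omega>))))"
proof -
  have Z [measurable]: "Z k \<in> borel_measurable M" if "k \<in> I" for k using int[OF that] by simp
  let ?S = "\<lambda>\<omega>. \<Sum>k\<in>I. Z k \<omega> - expectation (Z k)"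
  let ?S' = "\<lambda>\<omega>. \<Sum>k\<in>I. - Z k \<omega> - expectation (\<lambda>\<omega>. - Z k \<omega>)"
  have neg: "?S' \<omega> = - ?S \<omega>" for \<omega> by (simp add: sum_subtractf sum_negf)
  have "prob {\<omega> \<in> space M. x < \<bar>?S \<omega>\<bar>}
      \<le> prob ({\<omega> \<in> space M. x < ?S \<omega>} \<union> {\<omega> \<in> space M. x < ?S' \<omega>})"
  proof (rule finite_measure_mono)
    have "x < ?S \<omega> \<or> x < ?S' \<omega>" if "x < \<bar>?S \<omega>\<bar>" for \<omega>
      using that neg[of \<omega>] by linarith
    then show "{\<omega> \<in> space M. x < \<bar>?S \<omega>\<bar>} \<subseteq> {\<omega> \<in> space M. x < ?S \<omega>} \<union> {\<omega> \<in> space M. x < ?S' \<omega>}"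
      by blast
  qed measurable
  also have "\<dots> \<le> prob {\<omega> \<in> space M. x < ?S \<omega>} + prob {\<omega> \<in> space M. x < ?S' \<omega>}"
    by (rule measure_Un_le) measurable
  finally show ?thesis
    using centred_sum_upper_tail[OF fin int dom(1) K l c x V]
      centred_sum_upper_tail[OF fin _ dom(2) K l c x, of V] int V c
    by (simp add: clip_uminus excess_uminus)
qed

section \<open>Summability of the mean excess over the truncation level\<close>

text \<open>Layer cake: the excess of \<open>\<bar>Z\<bar>\<close> over \<open>c\<close> is the length of the interval from \<open>c\<close> to \<open>\<bar>Z\<bar>\<close>.\<close>

lemma nn_integral_excess:
  assumes "sigma_finite_measure P" and Z [measurable]: "Z \<in> borel_measurable P" and c: "c \<ge> 0"
  shows "(\<integral>\<^sup>+\<omega>. ennreal (excess c (Z \<omega>)) \<partial>P)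
           = (\<integral>\<^sup>+t. indicator {c<..} t * emeasure P {\<omega> \<in> space P. \<bar>Z \<omega>\<bar> > t} \<partial>lborel)"
proof -
  interpret sigma_finite_measure P by fact
  interpret PL: pair_sigma_finite P "lborel :: real measure" ..
  have "(\<integral>\<^sup>+\<omega>. ennreal (excess c (Z \<omega>)) \<partial>P)
      = (\<integral>\<^sup>+\<omega>. \<integral>\<^sup>+t. indicator {p. c < snd p \<and> snd p < \<bar>fst p\<bar>} (Z \<omega>, t) \<partial>lborel \<partial>P)"
  proof (rule nn_integral_cong)
    fix \<omega>
    have "(\<integral>\<^sup>+t. indicator {p. c < snd p \<and> snd p < \<bar>fst p\<bar>} (Z \<omega>, t) \<partial>lborel)
        = (\<integral>\<^sup>+t. indicator {c<..<\<bar>Z \<omega>\<bar>} t \<partial>lborel)"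
      by (intro nn_integral_cong) (auto simp: indicator_def)
    also have "\<dots> = ennreal (excess c (Z \<omega>))"
      by (cases "c \<le> \<bar>Z \<omega>\<bar>") (auto simp: excess_def)
    finally show "ennreal (excess c (Z \<omega>))
        = (\<integral>\<^sup>+t. indicator {p. c < snd p \<and> snd p < \<bar>fst p\<bar>} (Z \<omega>, t) \<partial>lborel)" ..
  qed
  also have "\<dots> = (\<integral>\<^sup>+t. \<integral>\<^sup>+\<omega>. indicator {p. c < snd p \<and> snd p < \<bar>fst p\<bar>} (Z \<omega>, t) \<partial>P \<partial>lborel)"
    by (rule PL.Fubini'[symmetric]) measurable
  also have "\<dots> = (\<integral>\<^sup>+t. indicator {c<..} t * emeasure P {\<omega> \<in> space P. \<bar>Z \<omega>\<bar> > t} \<partial>lborel)"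
  proof (rule nn_integral_cong)
    fix t :: real
    have "(\<integral>\<^sup>+\<omega>. indicator {p. c < snd p \<and> snd p < \<bar>fst p\<bar>} (Z \<omega>, t) \<partial>P)
        = (\<integral>\<^sup>+\<omega>. indicator {c<..} t * indicator {\<omega> \<in> space P. \<bar>Z \<omega>\<bar> > t} \<omega> \<partial>P)"
      by (intro nn_integral_cong) (auto simp: indicator_def)
    then show "(\<integral>\<^sup>+\<omega>. indicator {p. c < snd p \<and> snd p < \<bar>fst p\<bar>} (Z \<omega>, t) \<partial>P)
        = indicator {c<..} t * emeasure P {\<omega> \<in> space P. \<bar>Z \<omega>\<bar> > t}"
      by (simp add: nn_integral_cmult)
  qed
  finally show ?thesis .
qed

lemma (in sigma_finite_measure) measurable_tail [measurable]:
  assumes [measurable]: "Z \<in> borel_measurable M"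
  shows "(\<lambda>t. emeasure M {\<omega> \<in> space M. \<bar>Z \<omega>\<bar> > t}) \<in> borel_measurable (borel :: real measure)"
  by measurable

lemma (in prob_space) sum_excess_le_of_mean_dominated:
  assumes X: "\<And>k. 1 \<le> k \<Longrightarrow> k \<le> n \<Longrightarrow> X n k \<in> borel_measurable M"
    and Y: "Y \<in> borel_measurable M"
    and C: "C > 0" and dom: "\<And>t. t > 0 \<Longrightarrow>
        1 / real n * (\<Sum>k=1..n. prob {\<omega> \<in> space M. \<bar>X n k \<omega>\<bar> > t}) \<le> C * prob {\<omega> \<in> space M. \<bar>Y \<omega>\<bar> > t}"
    and n: "n \<ge> 1" and c: "c \<ge> 0"
  shows "(\<Sum>k=1..n. \<integral>\<^sup>+\<omega>. ennreal (excess c (X n k \<omega>)) \<partial>M)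
           \<le> ennreal (real n * C) * (\<integral>\<^sup>+\<omega>. ennreal (excess c (Y \<omega>)) \<partial>M)"
proof -
  note measurable_tail[OF X, measurable] measurable_tail[OF Y, measurable]
  have "(\<Sum>k=1..n. \<integral>\<^sup>+\<omega>. ennreal (excess c (X n k \<omega>)) \<partial>M)
      = (\<Sum>k=1..n. \<integral>\<^sup>+t. indicator {c<..} t * emeasure M {\<omega> \<in> space M. \<bar>X n k \<omega>\<bar> > t} \<partial>lborel)"
    using X by (intro sum.cong refl nn_integral_excess sigma_finite_measure_axioms c) auto
  also have "\<dots> = (\<integral>\<^sup>+t. (\<Sum>k=1..n. indicator {c<..} t * emeasure M {\<omega> \<in> space M. \<bar>X n k \<omega>\<bar> > t}) \<partial>lborel)"
    by (rule nn_integral_sum[symmetric]) auto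
  also have "\<dots> \<le> (\<integral>\<^sup>+t. ennreal (real n * C) * (indicator {c<..} t * emeasure M {\<omega> \<in> space M. \<bar>Y \<omega>\<bar> > t}) \<partial>lborel)"
  proof (rule nn_integral_mono)
    fix t :: real
    show "(\<Sum>k=1..n. indicator {c<..} t * emeasure M {\<omega> \<in> space M. \<bar>X n k \<omega>\<bar> > t})
        \<le> ennreal (real n * C) * (indicator {c<..} t * emeasure M {\<omega> \<in> space M. \<bar>Y \<omega>\<bar> > t})"
    proof (cases "t > c")
      case True
      have "(\<Sum>k=1..n. prob {\<omega> \<in> space M. \<bar>X n k \<omega>\<bar> > t}) \<le> real n * C * prob {\<omega> \<in> space M. \<bar>Y \<omega>\<bar> > t}"
        using dom[of t] True c n by (simp add: field_simps)
      then have "ennreal (\<Sum>k=1..n. prob {\<omega> \<in> space M. \<bar>X n k \<omega>\<bar> > t})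
          \<le> ennreal (real n * C * prob {\<omega> \<in> space M. \<bar>Y \<omega>\<bar> > t})" by (rule ennreal_leI)
      then show ?thesis using True C
        by (simp add: emeasure_eq_measure ennreal_mult)
    qed simp
  qed
  also have "\<dots> = ennreal (real n * C) * (\<integral>\<^sup>+t. indicator {c<..} t * emeasure M {\<omega> \<in> space M. \<bar>Y \<omega>\<bar> > t} \<partial>lborel)"
    by (rule nn_integral_cmult) auto
  finally show ?thesis
    using nn_integral_excess[OF sigma_finite_measure_axioms Y c] by simp
qed

text \<open>The excess over level \<open>0\<close> is the absolute value; domination of the mean of a row still bounds each
  of its entries, at the price of the row length.\<close>

lemma (in prob_space) integrable_of_mean_dominated:
  assumes X: "\<And>n k. 1 \<le> k \<Longrightarrow> k \<le> n \<Longrightarrow> X n k \<in> borel_measurable M"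
    and Y: "integrable M (\<lambda>\<omega>. \<bar>Y \<omega>\<bar>)" "Y \<in> borel_measurable M"
    and dom: "weakly_mean_dominated M X Y" and k: "1 \<le> k" "k \<le> n"
  shows "integrable M (X n k)"
proof -
  obtain C where C: "C > 0" "\<And>t n. t > 0 \<Longrightarrow> n \<ge> 1 \<Longrightarrow>
      1 / real n * (\<Sum>k=1..n. prob {\<omega> \<in> space M. \<bar>X n k \<omega>\<bar> > t}) \<le> C * prob {\<omega> \<in> space M. \<bar>Y \<omega>\<bar> > t}"
    using dom unfolding weakly_mean_dominated_def by auto
  have "(\<integral>\<^sup>+\<omega>. ennreal \<bar>X n k \<omega>\<bar> \<partial>M) = (\<integral>\<^sup>+\<omega>. ennreal (excess 0 (X n k \<omega>)) \<partial>M)"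
    by (simp add: excess_def)
  also have "\<dots> \<le> (\<Sum>k=1..n. \<integral>\<^sup>+\<omega>. ennreal (excess 0 (X n k \<omega>)) \<partial>M)"
    using k by (intro member_le_sum) auto
  also have "\<dots> \<le> ennreal (real n * C) * (\<integral>\<^sup>+\<omega>. ennreal (excess 0 (Y \<omega>)) \<partial>M)"
    using k X Y C by (intro sum_excess_le_of_mean_dominated) auto
  also have "(\<integral>\<^sup>+\<omega>. ennreal (excess 0 (Y \<omega>)) \<partial>M) = (\<integral>\<^sup>+\<omega>. ennreal \<bar>Y \<omega>\<bar> \<partial>M)"
    by (simp add: excess_def)
  also have "ennreal (real n * C) * \<dots> < \<infinity>"
    using Y(1) by (auto simp: nn_integral_eq_integral ennreal_mult_less_top)
  finally show ?thesis using X[OF k] by (intro integrableI_bounded) auto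
qed

text \<open>Places every \<open>n\<close> with \<open>a n \<le> t\<close> in the range of the inner integral of hypothesis (f). Above the supremum of \<open>f\<close>
  the generalized inverse is infinite, so that the claim survives when \<open>a\<close> is bounded.\<close>

lemma le_floor_gen_inverse:
  assumes ext: "increasing_extension a f" and n: "n \<ge> 1" and t: "a n \<le> t"
  shows "ereal (real n) \<le> ereal_floor (gen_inverse f t)"
proof -
  have mono: "strict_mono_on {0..} f" and fn: "f (real n) = a n"
    using ext n by (auto simp: increasing_extension_def)
  have "f 0 < f (real n)" using mono n by (auto simp: strict_mono_on_def)
  then have nt: "\<not> t < f 0" using fn t by simp
  show ?thesis
  proof (cases "t \<in> f ` {0..}")
    case True
    then obtain v where v: "v \<ge> 0" "t = f v" by auto
    have "the_inv_into {0..} f t = v"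
      using v strict_mono_on_imp_inj_on[OF mono] by (auto simp: the_inv_into_f_f)
    moreover have "real n \<le> v"
    proof (rule ccontr)
      assume "\<not> real n \<le> v"
      then have "f v < f (real n)" using mono v by (auto simp: strict_mono_on_def)
      then show False using t v fn by simp
    qed
    then have "int n \<le> \<lfloor>v\<rfloor>" by (simp add: le_floor_iff)
    then have "real n \<le> real_of_int \<lfloor>v\<rfloor>" by linarith
    ultimately show ?thesis using nt True by (simp add: gen_inverse_def ereal_floor_def)
  next
    case False
    then show ?thesis using nt by (simp add: gen_inverse_def ereal_floor_def)
  qed
qed

text \<open>Comparison of \<open>\<Sum> n / b n\<close> with \<open>\<integral> u / b u\<close>. On the upper half of the interval from \<open>n\<close> to \<open>n + 1\<close> the integrand is at least
  \<open>(n + 1) / (2 b (n + 1))\<close>; with the length \<open>1/2\<close> this gives the factor \<open>4\<close>. The lower half is given up because there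
  \<open>u\<close> is not comparable to \<open>n + 1\<close> when \<open>n = 0\<close>.\<close>

lemma suminf_le_nn_integral_ratio:
  assumes ext: "nondecreasing_extension b f" and S: "\<And>n. n \<in> N \<Longrightarrow> {0..real (Suc n)} \<subseteq> S"
  shows "(\<Sum>n. ennreal (real (Suc n) / (4 * b (Suc n))) * indicator N n)
           \<le> (\<integral>\<^sup>+u\<in>S. ennreal (u / f u) \<partial>lborel)"
proof -
  have mono: "mono_on {0..} f" and fn: "\<And>n. f (real (Suc n)) = b (Suc n)" and pos: "\<And>t. t > 0 \<Longrightarrow> f t > 0"
    using ext by (auto simp: nondecreasing_extension_def simp del: of_nat_Suc)
  have bpos: "b (Suc n) > 0" for n using pos[of "real (Suc n)"] fn[of n] by simp
  define J where "J n = {real n + 1/2<..real n + 1}" for n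
  define h where "h = (\<lambda>n u. ennreal (real (Suc n) / (2 * b (Suc n))) * indicator N n * indicator (J n) u)"
  have hint: "(\<integral>\<^sup>+u. h n u \<partial>lborel) = ennreal (real (Suc n) / (4 * b (Suc n))) * indicator N n" for n
  proof -
    have "emeasure lborel (J n) = ennreal (1/2)" by (simp add: J_def)
    then have "(\<integral>\<^sup>+u. h n u \<partial>lborel) = ennreal (real (Suc n) / (2 * b (Suc n))) * indicator N n * ennreal (1/2)"
      unfolding h_def by (subst nn_integral_cmult_indicator) (auto simp: J_def)
    also have "\<dots> = ennreal (real (Suc n) / (2 * b (Suc n))) * ennreal (1/2) * indicator N n"
      by (simp only: mult_ac)
    also have "ennreal (real (Suc n) / (2 * b (Suc n))) * ennreal (1/2) = ennreal (real (Suc n) / (4 * b (Suc n)))"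
      using bpos[of n] by (subst ennreal_mult[symmetric]) (auto simp: field_simps)
    finally show ?thesis .
  qed
  have "(\<Sum>n. ennreal (real (Suc n) / (4 * b (Suc n))) * indicator N n) = (\<integral>\<^sup>+u. (\<Sum>n. h n u) \<partial>lborel)"
    unfolding hint[symmetric] by (rule nn_integral_suminf[symmetric]) (auto simp: h_def J_def)
  also have "\<dots> \<le> (\<integral>\<^sup>+u\<in>S. ennreal (u / f u) \<partial>lborel)"
  proof (rule nn_integral_mono)
    fix u :: real
    show "(\<Sum>n. h n u) \<le> ennreal (u / f u) * indicator S u"
    proof (cases "\<exists>n\<in>N. u \<in> J n")
      case False
      then have "h n u = 0" for n by (auto simp: h_def indicator_def)
      then show ?thesis by simp
    next
      case True
      then obtain n where n: "n \<in> N" "u \<in> J n" by blast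
      have "m = n" if "u \<in> J m" for m
        using that n(2) by (auto simp: J_def)
      then have "h m u = 0" if "m \<notin> {n}" for m using that by (auto simp: h_def indicator_def)
      then have "(\<Sum>m. h m u) = h n u" by (subst suminf_finite[of "{n}"]) auto
      also have "\<dots> = ennreal (real (Suc n) / (2 * b (Suc n)))" using n by (simp add: h_def)
      also have "\<dots> \<le> ennreal (u / f u)"
      proof (rule ennreal_leI)
        have u: "u > 0" "real (Suc n) / 2 \<le> u" "u \<le> real (Suc n)" using n(2) by (auto simp: J_def)
        have "f u \<le> b (Suc n)" using mono_onD[OF mono, of u "real (Suc n)"] u fn[of n] by simp
        then have "(real (Suc n) / 2) / b (Suc n) \<le> u / f u"
          using u pos[of u] by (intro frac_le) auto
        then show "real (Suc n) / (2 * b (Suc n)) \<le> u / f u" by (simp add: field_simps)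
      qed
      also have "u \<in> S" using S[OF n(1)] n(2) by (auto simp: J_def)
      then have "ennreal (u / f u) = ennreal (u / f u) * indicator S u" by simp
      finally show ?thesis .
    qed
  qed
  finally show ?thesis .
qed

text \<open>Tonelli's theorem exchanges the sum over \<open>n\<close> with the layer-cake integral over \<open>t\<close>; for fixed \<open>t\<close> what remains is the
  sum of \<open>n / b n\<close> over \<open>a n < t\<close>, which the preceding two lemmas compare with the inner integral of (f).\<close>

lemma (in prob_space) summable_mean_excess:
  assumes X: "\<And>n k. 1 \<le> k \<Longrightarrow> k \<le> n \<Longrightarrow> integrable M (X n k)"
    and Y: "Y \<in> borel_measurable M" and dom: "weakly_mean_dominated M X Y"
    and a: "increasing_extension a a_ext" and b: "nondecreasing_extension b b_ext"
    and fin: "(\<integral>\<^sup>+t\<in>{0..}. emeasure M {\<omega> \<in> space M. \<bar>Y \<omega>\<bar> > t} *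
        (\<integral>\<^sup>+u\<in>{u. 0 \<le> u \<and> ereal u \<le> ereal_floor (gen_inverse a_ext t)}.
            ennreal (u / b_ext u) \<partial>lborel) \<partial>lborel) < \<infinity>"
  shows "summable (\<lambda>n. 1 / b (Suc n) * (\<Sum>k=1..Suc n. expectation (\<lambda>\<omega>. excess (a (Suc n)) (X (Suc n) k \<omega>))))"
proof -
  have apos: "a (Suc n) > 0" for n
    using a unfolding increasing_extension_def by (metis One_nat_def Suc_le_mono le0 of_nat_0_less_iff zero_less_Suc)
  have bpos: "b (Suc n) > 0" for n
    using b unfolding nondecreasing_extension_def by (metis One_nat_def Suc_le_mono le0 of_nat_0_less_iff zero_less_Suc)
  obtain C where C: "C > 0" "\<And>t n. t > 0 \<Longrightarrow> n \<ge> 1 \<Longrightarrow>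
      1 / real n * (\<Sum>k=1..n. prob {\<omega> \<in> space M. \<bar>X n k \<omega>\<bar> > t}) \<le> C * prob {\<omega> \<in> space M. \<bar>Y \<omega>\<bar> > t}"
    using dom unfolding weakly_mean_dominated_def by auto
  define G where "G t = emeasure M {\<omega> \<in> space M. \<bar>Y \<omega>\<bar> > t}" for t
  have [measurable]: "G \<in> borel_measurable borel"
    unfolding G_def using measurable_tail[OF Y] by simp
  define w where "w n = ennreal (real (Suc n) / (4 * b (Suc n)))" for n
  define E where "E n = (\<Sum>k=1..Suc n. expectation (\<lambda>\<omega>. excess (a (Suc n)) (X (Suc n) k \<omega>)))" for n
  have E0: "E n \<ge> 0" for n
    unfolding E_def by (intro sum_nonneg integral_nonneg_AE) (auto simp: excess_nonneg)
  have term_le: "ennreal (1 / b (Suc n) * E n)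
      \<le> ennreal (4 * C) * (w n * (\<integral>\<^sup>+t. indicator {a (Suc n)<..} t * G t \<partial>lborel))" for n
  proof -
    have ei: "integrable M (\<lambda>\<omega>. excess (a (Suc n)) (X (Suc n) k \<omega>))" if "k \<in> {1..Suc n}" for k
    proof (rule Bochner_Integration.integrable_bound)
      show "integrable M (X (Suc n) k)" using X that by auto
      show "AE \<omega> in M. norm (excess (a (Suc n)) (X (Suc n) k \<omega>)) \<le> norm (X (Suc n) k \<omega>)"
        using apos[of n] by (auto simp: excess_def)
    qed (use X that in auto)
    have "ennreal (E n) = (\<Sum>k=1..Suc n. ennreal (expectation (\<lambda>\<omega>. excess (a (Suc n)) (X (Suc n) k \<omega>))))"
      unfolding E_def
      by (rule sum_ennreal[symmetric]) (auto intro!: integral_nonneg_AE simp: excess_nonneg)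
    also have "\<dots> = (\<Sum>k=1..Suc n. \<integral>\<^sup>+\<omega>. ennreal (excess (a (Suc n)) (X (Suc n) k \<omega>)) \<partial>M)"
      by (intro sum.cong refl nn_integral_eq_integral[OF ei, symmetric]) (auto simp: excess_nonneg)
    also have "\<dots> \<le> ennreal (real (Suc n) * C) * (\<integral>\<^sup>+\<omega>. ennreal (excess (a (Suc n)) (Y \<omega>)) \<partial>M)"
    proof (rule sum_excess_le_of_mean_dominated[OF _ Y C(1) C(2)])
      show "0 \<le> a (Suc n)" using apos[of n] by simp
    qed (use X in auto)
    also have "\<dots> = ennreal (real (Suc n) * C) * (\<integral>\<^sup>+t. indicator {a (Suc n)<..} t * G t \<partial>lborel)"
      unfolding G_def using apos[of n] by (subst nn_integral_excess[OF sigma_finite_measure_axioms Y]) auto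
    finally have "ennreal (1 / b (Suc n)) * ennreal (E n)
        \<le> ennreal (1 / b (Suc n)) * (ennreal (real (Suc n) * C) * (\<integral>\<^sup>+t. indicator {a (Suc n)<..} t * G t \<partial>lborel))"
      by (rule mult_left_mono) simp
    moreover have "ennreal (1 / b (Suc n)) * ennreal (real (Suc n) * C) = ennreal (4 * C) * w n"
    proof -
      have "1 / b (Suc n) * (real (Suc n) * C) = 4 * C * (real (Suc n) / (4 * b (Suc n)))" by simp
      then show ?thesis
        unfolding w_def using C(1) bpos[of n] by (metis ennreal_mult' divide_nonneg_pos less_imp_le
            mult_nonneg_nonneg of_nat_0_le_iff zero_le_numeral zero_le_one)
    qed
    moreover have "ennreal (1 / b (Suc n) * E n) = ennreal (1 / b (Suc n)) * ennreal (E n)"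
      using E0[of n] bpos[of n] by (intro ennreal_mult) auto
    ultimately show ?thesis by (simp only: mult.assoc[symmetric])
  qed
  have "(\<Sum>n. w n * (\<integral>\<^sup>+t. indicator {a (Suc n)<..} t * G t \<partial>lborel))
      = (\<Sum>n. \<integral>\<^sup>+t. w n * (indicator {a (Suc n)<..} t * G t) \<partial>lborel)"
    by (intro suminf_cong nn_integral_cmult[symmetric]) auto
  also have "\<dots> = (\<integral>\<^sup>+t. (\<Sum>n. w n * (indicator {a (Suc n)<..} t * G t)) \<partial>lborel)"
    by (rule nn_integral_suminf[symmetric]) auto
  also have "\<dots> \<le> (\<integral>\<^sup>+t\<in>{0..}. G t *
        (\<integral>\<^sup>+u\<in>{u. 0 \<le> u \<and> ereal u \<le> ereal_floor (gen_inverse a_ext t)}.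
            ennreal (u / b_ext u) \<partial>lborel) \<partial>lborel)"
  proof (rule nn_integral_mono)
    fix t :: real
    let ?N = "{n. a (Suc n) < t}"
    let ?S = "{u. 0 \<le> u \<and> ereal u \<le> ereal_floor (gen_inverse a_ext t)}"
    show "(\<Sum>n. w n * (indicator {a (Suc n)<..} t * G t))
        \<le> G t * (\<integral>\<^sup>+u\<in>?S. ennreal (u / b_ext u) \<partial>lborel) * indicator {0..} t"
    proof (cases "t \<ge> 0")
      case False
      then have "t \<notin> {a (Suc n)<..}" for n using apos[of n] by auto
      then show ?thesis by simp
    next
      case True
      have "{0..real (Suc n)} \<subseteq> ?S" if "n \<in> ?N" for n
      proof
        fix u assume u: "u \<in> {0..real (Suc n)}"
        then have "ereal u \<le> ereal (real (Suc n))" by simp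
        also have "\<dots> \<le> ereal_floor (gen_inverse a_ext t)"
          using that by (intro le_floor_gen_inverse[OF a]) auto
        finally show "u \<in> ?S" using u by simp
      qed
      from suminf_le_nn_integral_ratio[OF b this]
      have le: "(\<Sum>n. w n * indicator ?N n) \<le> (\<integral>\<^sup>+u\<in>?S. ennreal (u / b_ext u) \<partial>lborel)"
        by (simp only: w_def)
      have "(\<Sum>n. w n * (indicator {a (Suc n)<..} t * G t)) = (\<Sum>n. G t * (w n * indicator ?N n))"
        by (intro suminf_cong) (auto simp: indicator_def mult_ac)
      also have "\<dots> = G t * (\<Sum>n. w n * indicator ?N n)" by (rule ennreal_suminf_cmult)
      also have "\<dots> \<le> G t * (\<integral>\<^sup>+u\<in>?S. ennreal (u / b_ext u) \<partial>lborel)"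
        by (intro mult_left_mono le) simp
      finally show ?thesis using True by simp
    qed
  qed
  also have "\<dots> < \<infinity>" using fin by (simp add: G_def)
  finally have finite_sum: "(\<Sum>n. w n * (\<integral>\<^sup>+t. indicator {a (Suc n)<..} t * G t \<partial>lborel)) < \<infinity>" .
  have "(\<Sum>n. ennreal (1 / b (Suc n) * E n))
      \<le> (\<Sum>n. ennreal (4 * C) * (w n * (\<integral>\<^sup>+t. indicator {a (Suc n)<..} t * G t \<partial>lborel)))"
    by (intro suminf_le term_le) auto
  also have "\<dots> = ennreal (4 * C) * (\<Sum>n. w n * (\<integral>\<^sup>+t. indicator {a (Suc n)<..} t * G t \<partial>lborel))"
    by (rule ennreal_suminf_cmult)
  also have "\<dots> < \<top>" using finite_sum by (simp add: ennreal_mult_less_top)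
  finally have "(\<Sum>n. ennreal (1 / b (Suc n) * E n)) \<noteq> \<top>" by simp
  then show ?thesis
    unfolding E_def[symmetric] using E0 bpos by (intro summable_suminf_not_top) (auto simp: less_imp_le)
qed

section \<open>Decay of the exponential term\<close>

text \<open>With \<open>q = a b / s\<close>, the exponent is \<open>b/a - (\<epsilon>/2) (b/a) ln q\<close>. Once \<open>ln q \<ge> 4/\<epsilon>\<close>, half of the logarithmic term absorbs \<open>b/a\<close>.
  The other half, \<open>(\<epsilon>/4) (b/a) ln q\<close>, is at least \<open>(\<epsilon>/4) \<delta> ln n\<close> by the lower limit, for any \<open>\<delta>\<close>.\<close>

lemma exponential_bound_eventually_le:
  fixes a b s M :: "nat \<Rightarrow> real"
  assumes pos: "\<And>n. n \<ge> 1 \<Longrightarrow> a n > 0" "\<And>n. n \<ge> 1 \<Longrightarrow> b n > 0" "\<And>n. n \<ge> 1 \<Longrightarrow> s n > 0"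
    and sab: "(\<lambda>n. s n / (a n * b n)) \<in> o(\<lambda>_. 1)"
    and ratio: "\<forall>\<delta>>0.
      liminf (\<lambda>n. ereal (b n * Log (a n * b n / s n) / (a n * Log (real n powr \<delta>)))) > 1"
    and M: "\<exists>\<alpha>>0. M \<in> O(\<lambda>n. real n powr \<alpha>)" and \<epsilon>: "\<epsilon> > 0"
  shows "\<exists>C. eventually (\<lambda>n. ln (a n * b n / s n) > 0 \<and>
      M n * exp (- (ln (a n * b n / s n) / a n * (\<epsilon> * b n / 2)) + b n / a n) \<le> C * real n powr - 2) sequentially"
proof -
  obtain \<alpha> where \<alpha>: "\<alpha> > 0" "M \<in> O(\<lambda>n. real n powr \<alpha>)" using M by auto
  obtain C where C: "C > 0" "eventually (\<lambda>n. norm (M n) \<le> C * norm (real n powr \<alpha>)) sequentially"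
    using landau_o.bigE[OF \<alpha>(2)] by blast
  \<comment> \<open>Chosen so that \<open>(\<epsilon>/4) \<delta> = \<alpha> + 2\<close>: the factor \<open>n powr \<alpha>\<close> from \<open>M\<close> is cancelled and \<open>n powr -2\<close> is left.\<close>
  define \<delta> where "\<delta> = 4 * (\<alpha> + 2) / \<epsilon>"
  have \<delta>: "\<delta> > 0" using \<alpha> \<epsilon> by (simp add: \<delta>_def)
  \<comment> \<open>The entry \<open>1\<close> of the maximum makes \<open>q \<ge> exp 1\<close>, so that \<open>Log q\<close> is the true logarithm.\<close>
  define r where "r = exp (max 1 (4 / \<epsilon>))"
  have r: "r > 0" by (simp add: r_def)
  have "eventually (\<lambda>n. norm (s n / (a n * b n)) \<le> 1 / r * norm (1::real)) sequentially"
    using landau_o.smallD[OF sab, of "1 / r"] r by simp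
  moreover have "eventually (\<lambda>n. ereal (b n * Log (a n * b n / s n) / (a n * Log (real n powr \<delta>))) > 1) sequentially"
    using less_LiminfD[of 1] ratio \<delta> by blast
  ultimately have "eventually (\<lambda>n. ln (a n * b n / s n) > 0 \<and>
      M n * exp (- (ln (a n * b n / s n) / a n * (\<epsilon> * b n / 2)) + b n / a n) \<le> C * real n powr - 2) sequentially"
    using C(2) eventually_ge_at_top[of 1]
  proof eventually_elim
    case (elim n)
    note p = pos[OF elim(4)]
    define q where "q = a n * b n / s n"
    have q: "q \<ge> r" "q > 0"
    proof -
      have "s n / (a n * b n) \<le> 1 / r" using elim(1) p by simp
      then show "q \<ge> r" using p r by (simp add: q_def field_simps)
      then show "q > 0" using r by linarith
    qed
    have lnq: "ln q \<ge> 1" "ln q \<ge> 4 / \<epsilon>"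
    proof -
      have "ln r \<le> ln q" using q r by simp
      then show "ln q \<ge> 1" "ln q \<ge> 4 / \<epsilon>" by (auto simp: r_def)
    qed
    have "exp 1 \<le> q" using lnq(1) q(2) by (simp add: ln_ge_iff)
    then have Logq: "Log q = ln q" by (simp add: Log_def max_absorb1)
    have npos: "real n > 0" using elim(4) by simp
    have "Log (real n powr \<delta>) \<ge> ln (real n powr \<delta>)" "Log (real n powr \<delta>) > 0"
    proof -
      show "Log (real n powr \<delta>) \<ge> ln (real n powr \<delta>)"
        unfolding Log_def using npos by (subst ln_le_cancel_iff) (auto simp: less_max_iff_disj)
      have "Log (real n powr \<delta>) \<ge> ln (exp 1)"
        unfolding Log_def by (subst ln_le_cancel_iff) (auto simp: less_max_iff_disj)
      then show "Log (real n powr \<delta>) > 0" by simp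
    qed
    note L = this
    have "1 < b n * ln q / (a n * Log (real n powr \<delta>))"
      using elim(2) Logq by (simp add: q_def)
    then have "a n * Log (real n powr \<delta>) < b n * ln q"
      using p L(2) by (simp add: field_simps)
    moreover have "a n * (\<delta> * ln (real n)) \<le> a n * Log (real n powr \<delta>)"
      using L(1) p npos by (intro mult_left_mono) (auto simp: ln_powr)
    ultimately have "a n * (\<delta> * ln (real n)) \<le> b n * ln q" by linarith
    then have "\<delta> * ln (real n) \<le> b n * ln q / a n"
      using p by (simp add: pos_le_divide_eq mult_ac)
    then have "(\<epsilon> / 4) * (\<delta> * ln (real n)) \<le> (\<epsilon> / 4) * (b n * ln q / a n)"
      using \<epsilon> by (intro mult_left_mono) auto
    moreover have "(\<epsilon> / 4) * (\<delta> * ln (real n)) = (\<alpha> + 2) * ln (real n)"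
      using \<epsilon> by (simp add: \<delta>_def)
    moreover have "b n / a n \<le> (\<epsilon> / 4) * (b n * ln q / a n)"
    proof -
      have "1 \<le> \<epsilon> / 4 * ln q" using lnq(2) \<epsilon> by (simp add: field_simps)
      then have "b n / a n * 1 \<le> b n / a n * (\<epsilon> / 4 * ln q)" using p by (intro mult_left_mono) auto
      then show ?thesis by (simp add: mult_ac)
    qed
    moreover have "ln q / a n * (\<epsilon> * b n / 2) = 2 * ((\<epsilon> / 4) * (b n * ln q / a n))"
      by (simp add: field_simps)
    ultimately have "- (ln q / a n * (\<epsilon> * b n / 2)) + b n / a n \<le> - (\<alpha> + 2) * ln (real n)"
      by (simp add: algebra_simps)
    then have "exp (- (ln q / a n * (\<epsilon> * b n / 2)) + b n / a n) \<le> real n powr (- (\<alpha> + 2))"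
      using npos by (simp add: powr_def)
    moreover have "M n \<le> C * real n powr \<alpha>" using elim(3) by simp
    ultimately have "M n * exp (- (ln q / a n * (\<epsilon> * b n / 2)) + b n / a n)
        \<le> (C * real n powr \<alpha>) * real n powr (- (\<alpha> + 2))"
      using C(1) by (intro mult_mono) auto
    also have "\<dots> = C * real n powr - 2" by (simp add: powr_add[symmetric])
    finally show ?case using lnq(1) by (simp add: q_def)
  qed
  then show ?thesis by blast
qed

section \<open>The strong law for row-wise END arrays\<close>

text \<open>Rewrites hypothesis (a) as a bound on the second moments of the truncated entries, the variance
  proxy of the tail estimate.\<close>

lemma (in prob_space) expectation_clip_square:
  assumes [measurable]: "Z \<in> borel_measurable M" and c: "c \<ge> 0"
  shows "expectation (\<lambda>\<omega>. (clip c (Z \<omega>))\<^sup>2)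
    = expectation (\<lambda>\<omega>. (Z \<omega>)\<^sup>2 * indicator {\<omega> \<in> space M. \<bar>Z \<omega>\<bar> \<le> c} \<omega>)
      + c\<^sup>2 * prob {\<omega> \<in> space M. \<bar>Z \<omega>\<bar> > c}"
proof -
  have int1: "integrable M (\<lambda>\<omega>. (Z \<omega>)\<^sup>2 * indicator {\<omega> \<in> space M. \<bar>Z \<omega>\<bar> \<le> c} \<omega>)"
  proof (rule integrable_const_bound[where B="c\<^sup>2"])
    have "norm ((Z \<omega>)\<^sup>2 * indicator {\<omega> \<in> space M. \<bar>Z \<omega>\<bar> \<le> c} \<omega>) \<le> c\<^sup>2" for \<omega>
      using c by (auto simp: indicator_def intro: power2_le_iff_abs_le[THEN iffD2])
    then show "AE \<omega> in M. norm ((Z \<omega>)\<^sup>2 * indicator {\<omega> \<in> space M. \<bar>Z \<omega>\<bar> \<le> c} \<omega>) \<le> c\<^sup>2" by simp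
  qed measurable
  have "expectation (\<lambda>\<omega>. (clip c (Z \<omega>))\<^sup>2)
    = expectation (\<lambda>\<omega>. (Z \<omega>)\<^sup>2 * indicator {\<omega> \<in> space M. \<bar>Z \<omega>\<bar> \<le> c} \<omega>
        + c\<^sup>2 * indicator {\<omega> \<in> space M. \<bar>Z \<omega>\<bar> > c} \<omega>)"
  proof (rule Bochner_Integration.integral_cong[OF refl])
    fix \<omega> assume "\<omega> \<in> space M"
    then show "(clip c (Z \<omega>))\<^sup>2 = (Z \<omega>)\<^sup>2 * indicator {\<omega> \<in> space M. \<bar>Z \<omega>\<bar> \<le> c} \<omega>
        + c\<^sup>2 * indicator {\<omega> \<in> space M. \<bar>Z \<omega>\<bar> > c} \<omega>"
      by (cases "Z \<omega> > c"; cases "Z \<omega> < - c") (use c in \<open>auto simp: clip_def indicator_def\<close>)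
  qed
  also have "\<dots> = expectation (\<lambda>\<omega>. (Z \<omega>)\<^sup>2 * indicator {\<omega> \<in> space M. \<bar>Z \<omega>\<bar> \<le> c} \<omega>)
      + c\<^sup>2 * prob {\<omega> \<in> space M. \<bar>Z \<omega>\<bar> > c}"
    by (subst Bochner_Integration.integral_add[OF int1])
       (auto simp: emeasure_eq_measure Int_absorb1)
  finally show ?thesis .
qed

lemma (in prob_space) row_wise_END_orthant_dominated:
  assumes X: "\<And>k. 1 \<le> k \<Longrightarrow> k \<le> n \<Longrightarrow> X n k \<in> borel_measurable M"
    and END: "row_wise_END M X K" and n: "n \<ge> 1"
  shows "orthant_dominated M {1..n} (X n) (K n)"
    and "orthant_dominated M {1..n} (\<lambda>k \<omega>. - X n k \<omega>) (K n)"
proof -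
  have e: "prob {\<omega> \<in> space M. \<forall>k\<in>{1..n}. X n k \<omega> > x k} \<le> K n * (\<Prod>k=1..n. prob {\<omega> \<in> space M. X n k \<omega> > x k})"
          "prob {\<omega> \<in> space M. \<forall>k\<in>{1..n}. X n k \<omega> \<le> x k} \<le> K n * (\<Prod>k=1..n. prob {\<omega> \<in> space M. X n k \<omega> \<le> x k})"
    for x :: "nat \<Rightarrow> real"
    using END n unfolding row_wise_END_def by blast+
  show "orthant_dominated M {1..n} (X n) (K n)"
    using X e(1) by (intro orthant_dominatedI_open) auto
  show "orthant_dominated M {1..n} (\<lambda>k \<omega>. - X n k \<omega>) (K n)"
    unfolding orthant_dominated_def using e(2)[of "\<lambda>k. - _ k"] by (simp add: le_minus_iff)
qed

theorem theorem1:
  fixes P :: "'w measure"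
    and X :: "nat \<Rightarrow> nat \<Rightarrow> 'w \<Rightarrow> real"
    and Y :: "'w \<Rightarrow> real"
    and M a b s :: "nat \<Rightarrow> real"
    and a_ext b_ext s_ext :: "real \<Rightarrow> real"
  assumes "prob_space P"
    and "\<And>n k. 1 \<le> k \<Longrightarrow> k \<le> n \<Longrightarrow> X n k \<in> borel_measurable P"
    and "Y \<in> borel_measurable P"
    and "row_wise_END P X M"
    and "weakly_mean_dominated P X Y"
    and "integrable P (\<lambda>\<omega>. \<bar>Y \<omega>\<bar>)"
    and "\<forall>n\<ge>1. a n > 0" and "strict_mono_on {1..} a" and "increasing_extension a a_ext"
    and "\<forall>n\<ge>1. b n > 0" and "mono_on {1..} b" and "nondecreasing_extension b b_ext"
    and "\<forall>n\<ge>1. s n > 0" and "mono_on {1..} s" and "nondecreasing_extension s s_ext"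
    and hyp_a: "\<forall>n\<ge>1.
      (\<Sum>k=1..n.
         (\<integral>\<omega>. (X n k \<omega>)\<^sup>2 * indicator {\<omega> \<in> space P. \<bar>X n k \<omega>\<bar> \<le> a n} \<omega> \<partial>P)
         + (a n)\<^sup>2 * measure P {\<omega> \<in> space P. \<bar>X n k \<omega>\<bar> > a n}) \<le> s n"
    and hyp_b: "(\<lambda>n. s n / (a n * b n)) \<in> o(\<lambda>_. 1)"
    and hyp_c: "(\<lambda>n. s n / ((a n)\<^sup>2 * Log (real n))) \<in> o(\<lambda>_. 1)"
    and hyp_d: "\<forall>\<delta>>0.
      liminf (\<lambda>n. ereal (b n * Log (a n * b n / s n) / (a n * Log (real n powr \<delta>)))) > 1"
    and hyp_e: "(\<integral>\<^sup>+u\<in>{0..}. ennreal (1 / Log u) *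
        (\<integral>\<^sup>+t\<in>{real_of_int \<lfloor>u\<rfloor>..}.
            ennreal (Log (a_ext t * b_ext t / s_ext t)) *
            emeasure P {\<omega> \<in> space P. gen_inverse a_ext \<bar>Y \<omega>\<bar> > ereal t} \<partial>lborel) \<partial>lborel) < \<infinity>"
    and hyp_f: "(\<integral>\<^sup>+t\<in>{0..}. emeasure P {\<omega> \<in> space P. \<bar>Y \<omega>\<bar> > t} *
        (\<integral>\<^sup>+u\<in>{u. 0 \<le> u \<and> ereal u \<le> ereal_floor (gen_inverse a_ext t)}.
            ennreal (u / b_ext u) \<partial>lborel) \<partial>lborel) < \<infinity>"
    and hyp_g: "\<exists>\<alpha>>0. M \<in> O(\<lambda>n. real n powr \<alpha>)"
  shows "(\<forall>\<epsilon>>0. summable (\<lambda>m. let n = Suc m in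
            measure P {\<omega> \<in> space P.
              \<bar>1 / b n * (\<Sum>k=1..n. X n k \<omega> - (\<integral>\<omega>'. X n k \<omega>' \<partial>P))\<bar> > \<epsilon>}))
         \<and> (AE \<omega> in P.
              (\<lambda>n. 1 / b n * (\<Sum>k=1..n. X n k \<omega> - (\<integral>\<omega>'. X n k \<omega>' \<partial>P))) \<longlonglongrightarrow> 0)"
proof -
  interpret prob_space P by fact
  note X = assms(2) and Y = assms(3) and END = assms(4) and dom = assms(5) and Yint = assms(6)
  note a_ext = assms(9) and b_ext = assms(12)
  have pos: "a n > 0" "b n > 0" "s n > 0" if "n \<ge> 1" for n
    using assms(7,10,13) that by auto
  have Xint: "integrable P (X n k)" if "1 \<le> k" "k \<le> n" for n k
    using integrable_of_mean_dominated[OF X Yint Y dom that] .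
  let ?mean = "\<lambda>n \<omega>. 1 / b n * (\<Sum>k=1..n. X n k \<omega> - expectation (X n k))"
  have meas: "?mean n \<in> borel_measurable P" for n
    using X by (intro borel_measurable_times borel_measurable_const borel_measurable_sum
        borel_measurable_diff) auto
  have summ: "summable (\<lambda>m. prob {\<omega> \<in> space P. \<bar>?mean (Suc m) \<omega>\<bar> > \<epsilon>})" if \<epsilon>: "\<epsilon> > 0" for \<epsilon>
  proof -
    define E where "E n = (\<Sum>k=1..n. expectation (\<lambda>\<omega>. excess (a n) (X n k \<omega>)))" for n
    define D where "D n = M n * exp (- (ln (a n * b n / s n) / a n * (\<epsilon> * b n / 2)) + b n / a n)" for n
    have "\<exists>C. eventually (\<lambda>n. ln (a n * b n / s n) > 0 \<and> D n \<le> C * real n powr - 2) sequentially"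
      unfolding D_def
      by (rule exponential_bound_eventually_le[OF _ _ _ hyp_b hyp_d hyp_g \<epsilon>]) (rule pos, assumption)+
    then obtain C where
      C: "eventually (\<lambda>n. ln (a n * b n / s n) > 0 \<and> D n \<le> C * real n powr - 2) sequentially" ..
    have row: "prob {\<omega> \<in> space P. \<bar>?mean n \<omega>\<bar> > \<epsilon>} \<le> 2 * (D n + 4 / \<epsilon> * (1 / b n * E n))"
      if n: "n \<ge> 1" and q: "ln (a n * b n / s n) > 0" for n
    proof -
      note p = pos[OF n]
      define q where "q = a n * b n / s n"
      \<comment> \<open>This choice makes \<open>exp (l * a n) = q\<close>, so the second-moment term \<open>(s/a\<^sup>2) exp (l * a)\<close> becomes \<open>b/a\<close>.\<close>
      define l where "l = ln q / a n"
      have l: "l > 0" "exp (l * a n) = q"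
        using q p by (auto simp: l_def q_def)
      have V: "(\<Sum>k=1..n. expectation (\<lambda>\<omega>. (clip (a n) (X n k \<omega>))\<^sup>2)) \<le> s n"
      proof -
        have "(\<Sum>k=1..n. expectation (\<lambda>\<omega>. (clip (a n) (X n k \<omega>))\<^sup>2))
          = (\<Sum>k=1..n. expectation (\<lambda>\<omega>. (X n k \<omega>)\<^sup>2 * indicator {\<omega> \<in> space P. \<bar>X n k \<omega>\<bar> \<le> a n} \<omega>)
               + (a n)\<^sup>2 * prob {\<omega> \<in> space P. \<bar>X n k \<omega>\<bar> > a n})"
          using X p(1) by (intro sum.cong refl expectation_clip_square) auto
        then show ?thesis using hyp_a n by simp
      qed
      have Mn: "M n \<ge> 0" using END n by (auto simp: row_wise_END_def less_imp_le)
      note orth = row_wise_END_orthant_dominated[OF X END n]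
      have "\<bar>?mean n \<omega>\<bar> = \<bar>\<Sum>k=1..n. X n k \<omega> - expectation (X n k)\<bar> / b n" for \<omega>
        using p(2) by (simp only: abs_mult abs_divide abs_one abs_of_pos times_divide_eq_left mult_1)
      then have event: "\<bar>?mean n \<omega>\<bar> > \<epsilon> \<longleftrightarrow> \<epsilon> * b n < \<bar>\<Sum>k=1..n. X n k \<omega> - expectation (X n k)\<bar>" for \<omega>
        using p(2) by (simp only: pos_less_divide_eq)
      have "prob {\<omega> \<in> space P. \<bar>?mean n \<omega>\<bar> > \<epsilon>}
          = prob {\<omega> \<in> space P. \<epsilon> * b n < \<bar>\<Sum>k=1..n. X n k \<omega> - expectation (X n k)\<bar>}"
        by (simp only: event)
      also have "\<dots> \<le> 2 * (M n * exp (- (l * (\<epsilon> * b n / 2)) + s n / (a n)\<^sup>2 * exp (l * a n))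
             + 4 / (\<epsilon> * b n) * E n)"
        unfolding E_def
      proof (rule centred_sum_tail[OF _ _ orth Mn l(1) p(1) _ V])
        show "integrable P (X n k)" if "k \<in> {1..n}" for k using Xint that by simp
      qed (use \<epsilon> p in auto)
      also have "s n / (a n)\<^sup>2 * exp (l * a n) = b n / a n"
        using p by (simp add: l(2) q_def power2_eq_square)
      also have "4 / (\<epsilon> * b n) * E n = 4 / \<epsilon> * (1 / b n * E n)" by simp
      finally show ?thesis by (simp only: D_def l_def q_def)
    qed
    show ?thesis
    proof (rule summable_comparison_test_ev)
      have "eventually (\<lambda>n. ln (a (Suc n) * b (Suc n) / s (Suc n)) > 0
          \<and> D (Suc n) \<le> C * real (Suc n) powr - 2) sequentially"
        by (rule eventually_compose_filterlim[OF C filterlim_Suc])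
      then show "eventually (\<lambda>n. norm (prob {\<omega> \<in> space P. \<bar>?mean (Suc n) \<omega>\<bar> > \<epsilon>})
          \<le> 2 * (C * real (Suc n) powr - 2 + 4 / \<epsilon> * (1 / b (Suc n) * E (Suc n)))) sequentially"
      proof eventually_elim
        case (elim n)
        then show ?case using row[of "Suc n"] by simp
      qed
      have "summable (\<lambda>n. real n powr - 2)" by (simp add: summable_real_powr_iff)
      then have "summable (\<lambda>n. real (Suc n) powr - 2)" by (subst summable_Suc_iff)
      moreover have "summable (\<lambda>n. 1 / b (Suc n) * E (Suc n))"
        unfolding E_def using summable_mean_excess[OF Xint Y dom a_ext b_ext hyp_f] .
      ultimately show "summable (\<lambda>n. 2 * (C * real (Suc n) powr - 2 + 4 / \<epsilon> * (1 / b (Suc n) * E (Suc n))))"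
        by (intro summable_mult summable_add)
    qed
  qed
  have "AE \<omega> in P. \<forall>j::nat. eventually (\<lambda>m. \<bar>?mean (Suc m) \<omega>\<bar> \<le> 1 / (real j + 1)) sequentially"
  proof (subst AE_all_countable, rule allI)
    fix j :: nat
    let ?A = "\<lambda>m. {\<omega> \<in> space P. \<bar>?mean (Suc m) \<omega>\<bar> > 1 / (real j + 1)}"
    have "AE \<omega> in P. eventually (\<lambda>m. \<omega> \<in> space P - ?A m) sequentially"
    proof (rule borel_cantelli_AE1)
      show "?A m \<in> events" for m using meas[of "Suc m"] by measurable
    qed (use summ[of "1 / (real j + 1)"] in \<open>auto simp: emeasure_eq_measure\<close>)
    then show "AE \<omega> in P. eventually (\<lambda>m. \<bar>?mean (Suc m) \<omega>\<bar> \<le> 1 / (real j + 1)) sequentially"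
      by eventually_elim (auto elim!: eventually_mono simp: not_less)
  qed
  then have "AE \<omega> in P. (\<lambda>n. ?mean n \<omega>) \<longlonglongrightarrow> 0"
  proof eventually_elim
    case (elim \<omega>)
    have "(\<lambda>m. ?mean (Suc m) \<omega>) \<longlonglongrightarrow> 0"
    proof (rule tendstoI)
      fix e :: real assume "e > 0"
      then obtain j where j: "1 / (real j + 1) < e"
        using reals_Archimedean[of e] by (auto simp: inverse_eq_divide add.commute)
      show "eventually (\<lambda>m. dist (?mean (Suc m) \<omega>) 0 < e) sequentially"
        using elim[rule_format, of j]
      proof eventually_elim
        case (elim m)
        then show ?case using j by (simp only: dist_real_def diff_0_right)
      qed
    qed
    then show ?case by (rule LIMSEQ_imp_Suc)
  qed
  then show ?thesis using summ by (simp only: Let_def) blast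
qed

end
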